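(* Let $\tilde\gamma=\zeta_1\circ\dots\circ\zeta_m\in\mathcal S_n$ be a monotone and ordered permutation with $\mathrm{supp}(\tilde\gamma)=[n]$, let $\Gamma\le\langle\tilde\gamma\rangle$, and let $I_0,I_1\subseteq[n]$ be disjoint. Then the procedure $\texttt{propagate}(\Gamma,I_0,I_1,1,\text{true})$ returns Feasible if and only if $\mathcal X_\Gamma\cap F(I_0,I_1)\ne\emptyset$. Moreover, (in the Feasible case) the returned sets $J_0$ and $J_1$ define the complete set of fixings of $\mathcal X_\Gamma\cap F(I_0,I_1)$, i.e. $J_b=\{i\in[n] : x_i=b\text{ for all }x\in\mathcal X_\Gamma\cap F(I_0,I_1)\}$ for $b\in\{0,1\}$.
   Context: $[n]=\{1,\dots,n\}$; $\mathcal S_n$ is the symmetric group on $[n]$. A permutation $\gamma$ acts on $x\in\mathbb R^n$ by $\gamma(x)=(x_{\gamma^{-1}(1)},\dots,x_{\gamma^{-1}(n)})$. $x\succeq y$ means that $x$ is lexicographically not smaller than $y$. $\mathcal X_\gamma=\{x\in\{0,1\}^n : x\succeq\gamma(x)\}$, $\mathcal X_\Gamma=\bigcap_{\gamma\in\Gamma}\mathcal X_\gamma$. $F(I_0,I_1)=\{x\in\{0,1\}^n : x_i=0 \text{ for } i\in I_0,\ x_i=1\text{ for } i\in I_1\}$. Monotone and ordered: $\zeta_1,\dots,\zeta_m$ are the disjoint (nontrivial) cycles of $\tilde\gamma$, with supports $N_c=\mathrm{supp}(\zeta_c)=\{k:\zeta_c(k)\ne k\}$, so that $[n]=N_1\,\dot\cup\cdots\dot\cup\,N_m$.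 Each $\zeta_c$ is monotone, i.e. there is exactly one $k$ with $\zeta_c(k)<k$; and they are ordered, i.e. for $c<c'$ all elements of $N_c$ are smaller than all elements of $N_{c'}$. For $I\subseteq[n]$ and a group $\Delta\le\mathcal S_n$: $\mathrm{STAB}(I,\Delta)=\{\gamma\in\Delta:\gamma(i)=i\ \forall i\in I\}$ and $\mathrm{stab}(I,\Delta)=\{\gamma\in\Delta:\gamma(i)\in I\ \forall i\in I\}$. $\mathrm{restr}(\gamma,I)$ is the map equal to $\gamma$ on $I$ and to the identity outside $I$, and $\mathrm{restr}(\Delta,I)=\{\mathrm{restr}(\gamma,I):\gamma\in\Delta\}$. A fixing $(i,b)\in[n]\times\{0,1\}$ is valid for $\gamma$ and $(J_0,J_1)$ if all $x\in\mathcal X_\gamma\cap F(J_0,J_1)$ have $x_i=b$. To "propagate $(J_0,J_1)$ individually for a set of permutations $\Pi$" means: repeatedly add to $J_b$ an index $i\notin J_0\cup J_1$ such that $(i,b)$ is valid for some $\gamma\in\Pi$, until no such fixing exists; if at some point $\mathcal X_\gamma\cap F(J_0,J_1)=\emptyset$ for some $\gamma\in\Pi$, infeasibility is detected. Procedure $\texttt{propagate}(\Gamma,I_0,I_1,k,\text{computeFixings})$, with $k\in[m]$: 1. Set $\Delta_k\gets\Gamma$ and $(J_0,J_1)\gets(I_0,I_1)$. 2. For $c=k,\dots,m$ do: (a) Propagate $(J_0,J_1)$ individually for the set $\mathrm{restr}(\Delta_c,N_c)$, and replace $(J_0,J_1)$ by the result. (b) If infeasibility was detected in (a), or if $\mathcal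 X_{\mathrm{restr}(\Delta_c,N_c)}\cap F(J_0\cap N_c,J_1\cap N_c)=\emptyset$, return Infeasible. (c) If computeFixings is true: let $(J_0',J_1')\gets(J_0,J_1)$; for each $i\in N_c\setminus(J_0'\cup J_1')$: if $\texttt{propagate}(\Delta_c,J_0\cup\{i\},J_1,c,\text{false})$ returns Infeasible, set $J_1\gets J_1\cup\{i\}$; else if $\texttt{propagate}(\Delta_c,J_0,J_1\cup\{i\},c,\text{false})$ returns Infeasible, set $J_0\gets J_0\cup\{i\}$. (d) If $N_c\subseteq J_0\cup J_1$, set $\Delta_{c+1}\gets\mathrm{stab}(J_0\cap N_c,\Delta_c)\cap\mathrm{stab}(J_1\cap N_c,\Delta_c)$; otherwise set $\Delta_{c+1}\gets\mathrm{STAB}(N_c,\Delta_c)$. 3. Return Feasible, together with $(J_0,J_1)$ if computeFixings is true. *)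

theory Defs
  imports Complex_Main "HOL-Algebra.Sym_Groups" "HOL-Library.Disjoint_Sets"
begin

subsection \<open>Symmetry handling constraints\<close>

text \<open>Vectors in \<open>\<real>\<^sup>n\<close> are functions on \<open>{1..n}\<close>; binary vectors are taken extensional,
  so that each point of the cube is represented exactly once.\<close>

definition cube :: "nat \<Rightarrow> (nat \<Rightarrow> real) set" where
  "cube n = {1..n} \<rightarrow>\<^sub>E {0, 1}"

definition perm_act :: "(nat \<Rightarrow> nat) \<Rightarrow> (nat \<Rightarrow> real) \<Rightarrow> nat \<Rightarrow> real" where
  "perm_act \<gamma> x = (\<lambda>i. x (inv' \<gamma> i))"

definition lex_geq :: "nat \<Rightarrow> (nat \<Rightarrow> real) \<Rightarrow> (nat \<Rightarrow> real) \<Rightarrow> bool" where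
  "lex_geq n x y \<longleftrightarrow>
     (\<forall>i\<in>{1..n}. x i = y i) \<or> (\<exists>i\<in>{1..n}. (\<forall>j\<in>{1..<i}. x j = y j) \<and> x i > y i)"

definition symre :: "nat \<Rightarrow> (nat \<Rightarrow> nat) \<Rightarrow> (nat \<Rightarrow> real) set" where
  "symre n \<gamma> = {x \<in> cube n. lex_geq n x (perm_act \<gamma> x)}"

definition symretope :: "nat \<Rightarrow> (nat \<Rightarrow> nat) set \<Rightarrow> (nat \<Rightarrow> real) set" where
  "symretope n P = (\<Inter>\<gamma>\<in>P. symre n \<gamma>)"

definition face :: "nat \<Rightarrow> nat set \<Rightarrow> nat set \<Rightarrow> (nat \<Rightarrow> real) set" where
  "face n I0 I1 = {x \<in> cube n. (\<forall>i\<in>I0. x i = 0) \<and> (\<forall>i\<in>I1. x i = 1)}"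

subsection \<open>Monotone and ordered permutations\<close>

definition supp :: "(nat \<Rightarrow> nat) \<Rightarrow> nat set" where
  "supp \<gamma> = {k. \<gamma> k \<noteq> k}"

definition nontrivial_cycle :: "(nat \<Rightarrow> nat) \<Rightarrow> bool" where
  "nontrivial_cycle \<zeta> \<longleftrightarrow> (\<exists>cs. cycle cs \<and> 2 \<le> length cs \<and> \<zeta> = cycle_of_list cs)"

definition disjoint_cycles :: "nat \<Rightarrow> (nat \<Rightarrow> nat \<Rightarrow> nat) \<Rightarrow> bool" where
  "disjoint_cycles m \<zeta> \<longleftrightarrow>
     (\<forall>c\<in>{1..m}. nontrivial_cycle (\<zeta> c)) \<and> disjoint_family_on (\<lambda>c. supp (\<zeta> c)) {1..m}"

definition monotone_cycle :: "(nat \<Rightarrow> nat) \<Rightarrow> bool" where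
  "monotone_cycle \<zeta> \<longleftrightarrow> (\<exists>!k. \<zeta> k < k)"

definition ordered_cycles :: "nat \<Rightarrow> (nat \<Rightarrow> nat \<Rightarrow> nat) \<Rightarrow> bool" where
  "ordered_cycles m \<zeta> \<longleftrightarrow>
     (\<forall>c\<in>{1..m}. \<forall>c'\<in>{1..m}. c < c' \<longrightarrow> (\<forall>i\<in>supp (\<zeta> c). \<forall>j\<in>supp (\<zeta> c'). i < j))"

subsection \<open>Stabilizers and restrictions\<close>

definition pointwise_stab :: "nat set \<Rightarrow> (nat \<Rightarrow> nat) set \<Rightarrow> (nat \<Rightarrow> nat) set" where
  "pointwise_stab I \<Delta> = {\<gamma> \<in> \<Delta>. \<forall>i\<in>I. \<gamma> i = i}"

definition setwise_stab :: "nat set \<Rightarrow> (nat \<Rightarrow> nat) set \<Rightarrow> (nat \<Rightarrow> nat) set" where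
  "setwise_stab I \<Delta> = {\<gamma> \<in> \<Delta>. \<forall>i\<in>I. \<gamma> i \<in> I}"

definition restr :: "(nat \<Rightarrow> nat) \<Rightarrow> nat set \<Rightarrow> nat \<Rightarrow> nat" where
  "restr \<gamma> I = (\<lambda>i. if i \<in> I then \<gamma> i else i)"

definition restr_set :: "(nat \<Rightarrow> nat) set \<Rightarrow> nat set \<Rightarrow> (nat \<Rightarrow> nat) set" where
  "restr_set \<Delta> I = (\<lambda>\<gamma>. restr \<gamma> I) ` \<Delta>"

subsection \<open>Individual propagation\<close>

definition valid_fixing ::
    "nat \<Rightarrow> (nat \<Rightarrow> nat) \<Rightarrow> nat set \<Rightarrow> nat set \<Rightarrow> nat \<Rightarrow> real \<Rightarrow> bool" where
  "valid_fixing n \<gamma> J0 J1 i b \<longleftrightarrow> (\<forall>x\<in>symre n \<gamma> \<inter> face n J0 J1. x i = b)"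

definition detects_infeasible :: "nat \<Rightarrow> (nat \<Rightarrow> nat) set \<Rightarrow> nat set \<Rightarrow> nat set \<Rightarrow> bool" where
  "detects_infeasible n P J0 J1 \<longleftrightarrow> (\<exists>\<gamma>\<in>P. symre n \<gamma> \<inter> face n J0 J1 = {})"

text \<open>Since the order in which fixings are found is left open, the algorithms are big-step
  relations between inputs and possible results (no run diverges, because every step adds an
  index or advances a loop). For \<open>propagate_individually\<close>, the result
  \<open>None\<close> means that infeasibility has been detected.\<close>

inductive propagate_individually ::
    "nat \<Rightarrow> (nat \<Rightarrow> nat) set \<Rightarrow> nat set \<Rightarrow> nat set \<Rightarrow> (nat set \<times> nat set) option \<Rightarrow> bool"
  for n :: nat and P :: "(nat \<Rightarrow> nat) set" where
  infeasible:
    "detects_infeasible n P J0 J1 \<Longrightarrow> propagate_individually n P J0 J1 None"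
| fix_zero:
    "\<lbrakk>\<not> detects_infeasible n P J0 J1; i \<in> {1..n}; i \<notin> J0 \<union> J1; \<gamma> \<in> P;
      valid_fixing n \<gamma> J0 J1 i 0; propagate_individually n P (J0 \<union> {i}) J1 r\<rbrakk>
     \<Longrightarrow> propagate_individually n P J0 J1 r"
| fix_one:
    "\<lbrakk>\<not> detects_infeasible n P J0 J1; i \<in> {1..n}; i \<notin> J0 \<union> J1; \<gamma> \<in> P;
      valid_fixing n \<gamma> J0 J1 i 1; propagate_individually n P J0 (J1 \<union> {i}) r\<rbrakk>
     \<Longrightarrow> propagate_individually n P J0 J1 r"
| stop:
    "\<lbrakk>\<not> detects_infeasible n P J0 J1;
      \<forall>i\<in>{1..n} - (J0 \<union> J1). \<forall>\<gamma>\<in>P. \<forall>b\<in>{0, 1}. \<not> valid_fixing n \<gamma> J0 J1 i b\<rbrakk>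
     \<Longrightarrow> propagate_individually n P J0 J1 (Some (J0, J1))"

subsection \<open>The procedure\<close>

datatype outcome = Infeasible | Feasible "(nat set \<times> nat set) option"

definition next_group ::
    "nat set \<Rightarrow> (nat \<Rightarrow> nat) set \<Rightarrow> nat set \<Rightarrow> nat set \<Rightarrow> (nat \<Rightarrow> nat) set" where
  "next_group Nc \<Delta> J0 J1 =
     (if Nc \<subseteq> J0 \<union> J1 then setwise_stab (J0 \<inter> Nc) \<Delta> \<inter> setwise_stab (J1 \<inter> Nc) \<Delta>
      else pointwise_stab Nc \<Delta>)"

text \<open>\<open>propagate n m N \<Gamma> I0 I1 k cf r\<close>: the procedure, called for the cycle supports
  \<open>N 1, \<dots>, N m\<close>, can return \<open>r\<close>; \<open>cf\<close> is the flag computeFixings.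

  \<open>propagate_loop\<close> describes the iterations \<open>c, \<dots>, m\<close> of the main loop, entered with group
  \<open>\<Delta>\<close> and fixings \<open>(J0, J1)\<close>.

  \<open>probe_fixings n m N c \<Delta> S J0 J1 K0 K1\<close> describes the inner loop that tests both values at
  every index in \<open>S\<close> (visited in arbitrary order) and turns \<open>(J0, J1)\<close> into \<open>(K0, K1)\<close>; the
  recursive calls use the current fixings, including those found at indices visited earlier.\<close>

inductive propagate ::
    "nat \<Rightarrow> nat \<Rightarrow> (nat \<Rightarrow> nat set) \<Rightarrow> (nat \<Rightarrow> nat) set \<Rightarrow> nat set \<Rightarrow> nat set \<Rightarrow>
     nat \<Rightarrow> bool \<Rightarrow> outcome \<Rightarrow> bool"
  and propagate_loop ::
    "nat \<Rightarrow> nat \<Rightarrow> (nat \<Rightarrow> nat set) \<Rightarrow> nat \<Rightarrow> bool \<Rightarrow> (nat \<Rightarrow> nat) set \<Rightarrow>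
     nat set \<Rightarrow> nat set \<Rightarrow> outcome \<Rightarrow> bool"
  and probe_fixings ::
    "nat \<Rightarrow> nat \<Rightarrow> (nat \<Rightarrow> nat set) \<Rightarrow> nat \<Rightarrow> (nat \<Rightarrow> nat) set \<Rightarrow> nat set \<Rightarrow>
     nat set \<Rightarrow> nat set \<Rightarrow> nat set \<Rightarrow> nat set \<Rightarrow> bool"
  for n m :: nat and N :: "nat \<Rightarrow> nat set" where
  start:
    "propagate_loop n m N k cf \<Gamma> I0 I1 r \<Longrightarrow> propagate n m N \<Gamma> I0 I1 k cf r"
| loop_end:
    "m < c \<Longrightarrow>
     propagate_loop n m N c cf \<Delta> J0 J1 (Feasible (if cf then Some (J0, J1) else None))"
| loop_infeasible_individual:
    "\<lbrakk>c \<le> m; propagate_individually n (restr_set \<Delta> (N c)) J0 J1 None\<rbrakk>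
     \<Longrightarrow> propagate_loop n m N c cf \<Delta> J0 J1 Infeasible"
| loop_infeasible_joint:
    "\<lbrakk>c \<le> m; propagate_individually n (restr_set \<Delta> (N c)) J0 J1 (Some (K0, K1));
      symretope n (restr_set \<Delta> (N c)) \<inter> face n (K0 \<inter> N c) (K1 \<inter> N c) = {}\<rbrakk>
     \<Longrightarrow> propagate_loop n m N c cf \<Delta> J0 J1 Infeasible"
| loop_without_fixings:
    "\<lbrakk>c \<le> m; propagate_individually n (restr_set \<Delta> (N c)) J0 J1 (Some (K0, K1));
      symretope n (restr_set \<Delta> (N c)) \<inter> face n (K0 \<inter> N c) (K1 \<inter> N c) \<noteq> {};
      propagate_loop n m N (Suc c) False (next_group (N c) \<Delta> K0 K1) K0 K1 r\<rbrakk>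
     \<Longrightarrow> propagate_loop n m N c False \<Delta> J0 J1 r"
| loop_with_fixings:
    "\<lbrakk>c \<le> m; propagate_individually n (restr_set \<Delta> (N c)) J0 J1 (Some (K0, K1));
      symretope n (restr_set \<Delta> (N c)) \<inter> face n (K0 \<inter> N c) (K1 \<inter> N c) \<noteq> {};
      probe_fixings n m N c \<Delta> (N c - (K0 \<union> K1)) K0 K1 L0 L1;
      propagate_loop n m N (Suc c) True (next_group (N c) \<Delta> L0 L1) L0 L1 r\<rbrakk>
     \<Longrightarrow> propagate_loop n m N c True \<Delta> J0 J1 r"
| probe_end:
    "probe_fixings n m N c \<Delta> {} J0 J1 J0 J1"
| probe_one:
    "\<lbrakk>i \<in> S; propagate n m N \<Delta> (J0 \<union> {i}) J1 c False Infeasible;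
      probe_fixings n m N c \<Delta> (S - {i}) J0 (J1 \<union> {i}) K0 K1\<rbrakk>
     \<Longrightarrow> probe_fixings n m N c \<Delta> S J0 J1 K0 K1"
| probe_zero:
    "\<lbrakk>i \<in> S; propagate n m N \<Delta> (J0 \<union> {i}) J1 c False (Feasible s);
      propagate n m N \<Delta> J0 (J1 \<union> {i}) c False Infeasible;
      probe_fixings n m N c \<Delta> (S - {i}) (J0 \<union> {i}) J1 K0 K1\<rbrakk>
     \<Longrightarrow> probe_fixings n m N c \<Delta> S J0 J1 K0 K1"
| probe_none:
    "\<lbrakk>i \<in> S; propagate n m N \<Delta> (J0 \<union> {i}) J1 c False (Feasible s);
      propagate n m N \<Delta> J0 (J1 \<union> {i}) c False (Feasible s');
      probe_fixings n m N c \<Delta> (S - {i}) J0 J1 K0 K1\<rbrakk>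
     \<Longrightarrow> probe_fixings n m N c \<Delta> S J0 J1 K0 K1"

end

theory Submission
  imports Defs
begin

text \<open>
  Monotone and ordered cycles act on consecutive intervals as cyclic shifts, so \<open>x \<succeq> \<gamma>(x)\<close> is decided
  block by block: the blocks \<open>N c, \<dots>, N m\<close> only matter for those \<open>\<gamma>\<close> that fix the earlier blocks of
  \<open>x\<close>. If a block is not entirely fixed after individual propagation, then some assignment of its free
  entries makes \<open>x\<close> strictly larger than \<open>\<gamma>(x)\<close> for every \<open>\<gamma>\<close> acting nontrivially on the block;
  hence only the pointwise stabilizer constrains the later blocks, and any solution there extends to
  the earlier ones. To find such an assignment, let \<open>f\<close> be the first free entry and set it to 1 and
  all other free entries to 0. Individual completeness forces the resulting word to be at least as large
  as each of its shifts, with equality only for shifts by at most \<open>f\<close>. If equality occurs, then \<open>f\<close>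
  lies in the last period of the word, and setting \<open>f\<close> to 0 as well makes all comparisons strict.
\<close>

subsection \<open>Lexicographic comparison\<close>

text \<open>Individual completeness treats one permutation at a time, and its witnesses may change
  with the permutation, the entry and the value. The obstacle is to serve all permutations with a
  single word. The greedy word is a candidate because it is built from the fixings alone; each
  witness is compared with it separately.

  The loop is measured against \<open>tail c \<Delta>\<close>, the binary points that satisfy all
  comparisons started at block \<open>c\<close>. One iteration keeps two things: whether this set
  meets the current face, and which values are forced outside the block. Backward induction over
  \<open>c\<close> then makes a run without fixings an exact emptiness test, and probing with such a
  test finds exactly the fixings of the block. Since runs are not deterministic, the result is shown
  for every run, and the existence of a run separately.

  A fully fixed block needs its own argument: the face determines the point there, each comparison
  is strict or a tie, and the ties form the setwise stabilizer of the zeros and ones.\<close>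

definition slex_on :: "nat set \<Rightarrow> (nat \<Rightarrow> real) \<Rightarrow> (nat \<Rightarrow> real) \<Rightarrow> bool" where
  "slex_on A x y \<longleftrightarrow> (\<exists>i\<in>A. (\<forall>j\<in>A. j < i \<longrightarrow> x j = y j) \<and> y i < x i)"

definition lex_on :: "nat set \<Rightarrow> (nat \<Rightarrow> real) \<Rightarrow> (nat \<Rightarrow> real) \<Rightarrow> bool" where
  "lex_on A x y \<longleftrightarrow> (\<forall>i\<in>A. x i = y i) \<or> slex_on A x y"

lemma lex_geq_iff_lex_on: "lex_geq n x y \<longleftrightarrow> lex_on {1..n} x y"
proof -
  have "(\<forall>j\<in>{1..<i}. x j = y j) \<longleftrightarrow> (\<forall>j\<in>{1..n}. j < i \<longrightarrow> x j = y j)" if "i \<in> {1..n}" for i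
    using that by auto
  then show ?thesis
    by (auto simp: lex_geq_def lex_on_def slex_on_def)
qed

lemma slex_on_cong:
  assumes "\<And>i. i \<in> A \<Longrightarrow> x i = x' i" "\<And>i. i \<in> A \<Longrightarrow> y i = y' i"
  shows "slex_on A x y \<longleftrightarrow> slex_on A x' y'"
  using assms by (auto simp: slex_on_def)

lemma lex_on_cong:
  assumes "\<And>i. i \<in> A \<Longrightarrow> x i = x' i" "\<And>i. i \<in> A \<Longrightarrow> y i = y' i"
  shows "lex_on A x y \<longleftrightarrow> lex_on A x' y'"
  using assms slex_on_cong[OF assms] by (simp add: lex_on_def)

lemma slex_on_Un:
  assumes "\<And>i j. i \<in> A \<Longrightarrow> j \<in> B \<Longrightarrow> i < j"
  shows "slex_on (A \<union> B) x y \<longleftrightarrow> slex_on A x y \<or> (\<forall>i\<in>A. x i = y i) \<and> slex_on B x y"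
    (is "?L \<longleftrightarrow> ?R")
proof
  assume ?L
  then obtain i where i: "i \<in> A \<union> B" "\<forall>j\<in>A \<union> B. j < i \<longrightarrow> x j = y j" "y i < x i"
    unfolding slex_on_def by blast
  then show ?R
    using assms unfolding slex_on_def by blast
next
  assume ?R
  then show ?L
    using assms unfolding slex_on_def by (metis UnE UnI1 UnI2 not_less_iff_gr_or_eq)
qed

lemma lex_on_Un:
  assumes "\<And>i j. i \<in> A \<Longrightarrow> j \<in> B \<Longrightarrow> i < j"
  shows "lex_on (A \<union> B) x y \<longleftrightarrow> slex_on A x y \<or> (\<forall>i\<in>A. x i = y i) \<and> lex_on B x y"
  using slex_on_Un[of A B x y, OF assms] by (auto simp: lex_on_def)

lemma slex_on_shift:
  "slex_on {a..<a + l} x y \<longleftrightarrow> slex_on {..<l} (\<lambda>r. x (a + r)) (\<lambda>r. y (a + r))" (is "?L \<longleftrightarrow> ?R")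
proof
  assume ?L
  then obtain i where i: "i \<in> {a..<a + l}" "\<forall>j\<in>{a..<a + l}. j < i \<longrightarrow> x j = y j" "y i < x i"
    unfolding slex_on_def by blast
  then show ?R
    unfolding slex_on_def by (intro bexI[of _ "i - a"]) auto
next
  assume ?R
  then obtain i where i: "i < l" "\<forall>j<l. j < i \<longrightarrow> x (a + j) = y (a + j)" "y (a + i) < x (a + i)"
    unfolding slex_on_def by blast
  have "x j = y j" if "j \<in> {a..<a + l}" "j < a + i" for j
    using i(1) i(2)[rule_format, of "j - a"] that by auto
  with i show ?L
    unfolding slex_on_def by (intro bexI[of _ "a + i"]) auto
qed

lemma lex_on_shift:
  "lex_on {a..<a + l} x y \<longleftrightarrow> lex_on {..<l} (\<lambda>r. x (a + r)) (\<lambda>r. y (a + r))"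
proof -
  have "(\<forall>i\<in>{a..<a + l}. x i = y i) \<longleftrightarrow> (\<forall>r<l. x (a + r) = y (a + r))"
    by (auto simp: le_iff_add)
  then show ?thesis
    by (simp add: lex_on_def slex_on_shift lessThan_def)
qed

lemma lex_on_superset:
  assumes "A \<subseteq> B" "\<And>i. i \<in> B - A \<Longrightarrow> x i = y i"
  shows "lex_on B x y \<longleftrightarrow> lex_on A x y"
proof -
  have "slex_on B x y \<longleftrightarrow> slex_on A x y"
    using assms unfolding slex_on_def by (metis DiffI less_irrefl subsetD)
  then show ?thesis
    using assms unfolding lex_on_def by (metis DiffI subsetD)
qed

lemma slex_onI:
  "k < l \<Longrightarrow> (\<And>i. i < k \<Longrightarrow> x i = y i) \<Longrightarrow> y k < x k \<Longrightarrow> slex_on {..<l} x y"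
  by (auto simp: slex_on_def)

lemma lex_on_leD:
  assumes "lex_on {..<l} x y" "k < l" "\<And>i. i < k \<Longrightarrow> x i = y i"
  shows "y k \<le> x k"
proof (cases "\<forall>i\<in>{..<l}. x i = y i")
  case True
  then show ?thesis using assms by simp
next
  case False
  then obtain i where i: "i < l" "\<forall>j<l. j < i \<longrightarrow> x j = y j" "y i < x i"
    using assms(1) by (auto simp: lex_on_def slex_on_def)
  then have "\<not> i < k"
    using assms(3)[of i] by auto
  then show ?thesis
    using i assms(2) by (cases "i = k") auto
qed

lemma lex_on_cases_prefix:
  assumes "lex_on {..<l} x y" "k \<le> l"
  shows "(\<forall>i<k. x i = y i) \<or> (\<exists>i<k. (\<forall>j<i. x j = y j) \<and> y i < x i)"
proof (cases "\<forall>i\<in>{..<l}. x i = y i")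
  case True
  then show ?thesis using assms by auto
next
  case False
  then obtain i where i: "i < l" "\<forall>j<l. j < i \<longrightarrow> x j = y j" "y i < x i"
    using assms(1) by (auto simp: lex_on_def slex_on_def)
  then show ?thesis
    using assms(2) by (cases "i < k") auto
qed

subsection \<open>Words and their rotations\<close>

text \<open>Words list the entries of one block by offset. Since \<open>perm_act\<close> reads
  \<open>x\<close> at \<open>inv' \<pi>\<close>, the shift \<open>u\<close> will be that of the
  inverse permutation on the block.\<close>

definition rot :: "nat \<Rightarrow> nat \<Rightarrow> (nat \<Rightarrow> real) \<Rightarrow> nat \<Rightarrow> real" where
  "rot l u v = (\<lambda>r. v ((r + u) mod l))"

definition fits :: "nat \<Rightarrow> nat set \<Rightarrow> nat set \<Rightarrow> (nat \<Rightarrow> real) \<Rightarrow> bool" where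
  "fits l A0 A1 v \<longleftrightarrow>
     (\<forall>r<l. v r \<in> {0, 1} \<and> (r \<in> A0 \<longrightarrow> v r = 0) \<and> (r \<in> A1 \<longrightarrow> v r = 1))"

text \<open>The word form of individual completeness: no fixing is valid for the single constraint
  given by the rotation by \<open>u\<close>. The witness \<open>v\<close> may depend on
  \<open>u\<close>, on the position and on the value.\<close>

definition unforced :: "nat \<Rightarrow> nat set \<Rightarrow> nat set \<Rightarrow> nat \<Rightarrow> bool" where
  "unforced l A0 A1 u \<longleftrightarrow>
     (\<forall>r<l. r \<notin> A0 \<union> A1 \<longrightarrow>
        (\<forall>b\<in>{0, 1}. \<exists>v. fits l A0 A1 v \<and> lex_on {..<l} v (rot l u v) \<and> v r = b))"

text \<open>The position \<open>f\<close> is the first free one. A word \<open>z\<close> with \<open>z f = 1\<close> that satisfies the constraint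
  exists by assumption; it dominates \<open>w\<close>, and unless \<open>w\<close> is strictly larger than its rotation, the
  ties in \<open>w\<close> propagate from left to right and force \<open>z = w\<close>.\<close>

lemma min_word_lex_or_periodic:
  fixes A0 A1 :: "nat set" and f l u :: nat
  defines "w \<equiv> \<lambda>r. if r \<in> insert f A1 then 1 else (0::real)"
  assumes u: "0 < u" "u < l" and dis: "A0 \<inter> A1 = {}"
    and f: "f < l" "f \<notin> A0 \<union> A1" "\<And>r. r < f \<Longrightarrow> r \<in> A0 \<union> A1"
    and unf: "unforced l A0 A1 u"
  shows "slex_on {..<l} w (rot l u w) \<or> u \<le> f \<and> (\<forall>r<l. w r = rot l u w r)"
proof (rule ccontr)
  assume neg: "\<not> ?thesis"
  define s where "s r = (r + u) mod l" for r
  have rot_s: "rot l u v r = v (s r)" for v r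
    by (simp add: rot_def s_def)
  have s_less: "s r < l" for r
    using u by (simp add: s_def)
  have s_neq: "s r \<noteq> r" if "r < l" for r
  proof (cases "r + u < l")
    case False
    then have "s r = r + u - l"
      using that u by (simp add: s_def le_mod_geq)
    then show ?thesis using u that False by linarith
  qed (use u in \<open>simp add: s_def\<close>)
  have nots: "\<not> slex_on {..<l} w (rot l u w)"
    using neg by blast
  have split: "\<exists>v. fits l A0 A1 v \<and> lex_on {..<l} v (rot l u v) \<and> v r = b"
    if "r < l" "r \<notin> A0" "r \<notin> A1" "b \<in> {0, 1}" for r and b :: real
    using unf that unfolding unforced_def by blast
  \<comment> \<open>Before the first position \<open>j\<close> without \<open>same\<close>, the
    fixings force every fitting word to tie with its rotation. Hence \<open>j\<close> is the first
    position where a comparison can be decided, for all words at once.\<close>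
  define same where "same r \<longleftrightarrow> r \<in> A0 \<and> s r \<in> A0 \<or> r \<in> A1 \<and> s r \<in> A1" for r
  define j where "j = (LEAST r. \<not> same r)"
  have "\<not> same f"
    using f by (simp add: same_def)
  then have j: "\<not> same j" "j \<le> f" and same: "\<And>r. r < j \<Longrightarrow> same r"
    unfolding j_def by (metis LeastI, simp add: Least_le, use not_less_Least in blast)
  have jl: "j < l" using j f by simp
  have tie: "v r = v (s r)" if "fits l A0 A1 v" "r < j" for v r
    using same[OF that(2)] that jl s_less[of r] unfolding same_def fits_def
    by (metis order_less_trans)
  have ge: "v (s j) \<le> v j" if "fits l A0 A1 v" "lex_on {..<l} v (rot l u v)" for v
    using lex_on_leD[OF that(2) jl] tie[OF that(1)] by (simp add: rot_s)
  have w_fits: "fits l A0 A1 w"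
    using f dis by (auto simp: fits_def w_def)
  obtain z where z: "fits l A0 A1 z" "lex_on {..<l} z (rot l u z)" "z f = 1"
    using split[of f 1] f by auto
  \<comment> \<open>If \<open>j\<close> were fixed to 0, every feasible word would have 0 at
    \<open>s j\<close>. By the choice of \<open>j\<close> this position is not itself fixed to 0, so
    a free entry would be forced. The claim \<open>s1\<close> is dual.\<close>
  have j0: "j \<notin> A0"
  proof
    assume "j \<in> A0"
    then have *: "v (s j) \<le> 0" if "fits l A0 A1 v" "lex_on {..<l} v (rot l u v)" for v
      using ge[OF that] that(1) jl by (auto simp: fits_def)
    have "s j \<notin> A0"
      using j \<open>j \<in> A0\<close> by (simp add: same_def)
    moreover have "s j \<notin> A1"
      using *[OF z(1,2)] z(1) s_less[of j] by (auto simp: fits_def)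
    ultimately obtain v where "fits l A0 A1 v" "lex_on {..<l} v (rot l u v)" "v (s j) = 1"
      using split[of "s j" 1] s_less by auto
    then show False using * by fastforce
  qed
  have s1: "s j \<notin> A1"
  proof
    assume "s j \<in> A1"
    then have *: "v j \<ge> 1" if "fits l A0 A1 v" "lex_on {..<l} v (rot l u v)" for v
      using ge[OF that] that(1) s_less[of j] by (auto simp: fits_def)
    have "j \<notin> A1"
      using j \<open>s j \<in> A1\<close> by (simp add: same_def)
    with j0 obtain v where "fits l A0 A1 v" "lex_on {..<l} v (rot l u v)" "v j = 0"
      using split[of j 0] jl by auto
    then show False using * by fastforce
  qed
  have "j \<in> A1 \<or> j = f"
    using j0 j(2) f(3)[of j] by auto
  then have wj: "w j = 1"
    by (auto simp: w_def)
  have sj: "s j = f"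
  proof (rule ccontr)
    assume "s j \<noteq> f"
    then have "w (s j) < w j"
      using wj s1 by (simp add: w_def)
    then show False
      using nots slex_onI[OF jl, of w "rot l u w"] tie[OF w_fits] by (simp add: rot_s)
  qed
  have jf: "j < f"
    using s_neq[OF jl] sj j(2) by auto
  \<comment> \<open>A wrap-around would give \<open>s j < j\<close>, whereas \<open>f\<close> lies
    after \<open>j\<close>.\<close>
  have ju: "j + u = f"
  proof (cases "j + u < l")
    case True
    then show ?thesis using sj by (simp add: s_def)
  next
    case False
    then have "(j + u) mod l = j + u - l"
      using jl u(2) by (simp add: le_mod_geq)
    then show ?thesis using False sj jf u(2) by (simp add: s_def)
  qed
  have w_le: "w r \<le> z r" if "r < l" for r
    using z that by (auto simp: w_def fits_def)
  have eq: "r < l \<Longrightarrow> z r = w r" for r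
  proof (induction r rule: less_induct)
    case (less r)
    show ?case
    proof (cases "r \<le> f")
      case True
      then show ?thesis
        using f(1) f(3)[of r] dis z(1,3) by (cases "r = f") (auto simp: w_def fits_def)
    next
      case False
      \<comment> \<open>The rotation shows entry \<open>r\<close> at position \<open>k\<close>.
        Before \<open>k\<close> both words tie with their rotations, so the comparison at
        \<open>k\<close> gives \<open>z r <= z k = w k <= w r\<close>, while \<open>z\<close>
        dominates \<open>w\<close>.\<close>
      define k where "k = r - u"
      have k: "k + u = r" "k < r" "s k = r" "k < l"
        using False ju less.prems u by (auto simp: k_def s_def)
      have below: "z i = w i" "z (s i) = w (s i)" if "i < k" for i
        using that less.IH[of i] less.IH[of "s i"] less.prems k by (auto simp: s_def)
      have "\<forall>i<k. z i = z (s i)"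
      proof (rule ccontr)
        assume "\<not> ?thesis"
        then obtain i where "i < k" "\<forall>j<i. z j = z (s j)" "z (s i) < z i"
          using lex_on_cases_prefix[OF z(2), of k] k by (auto simp: rot_s)
        then have "slex_on {..<l} w (rot l u w)"
          using slex_onI[of i l w "rot l u w"] below k by (simp add: rot_s)
        then show False using nots by blast
      qed
      then have zt: "z i = z (s i)" and wt: "w i = w (s i)" if "i < k" for i
        using that below by auto
      have "z r \<le> z k"
        using lex_on_leD[OF z(2) k(4)] zt k by (simp add: rot_s)
      moreover have "\<not> w r < w k"
        using slex_onI[OF k(4), of w "rot l u w"] wt nots k by (auto simp: rot_s)
      moreover have "z k = w k"
        using less.IH k by simp
      ultimately show ?thesis
        using w_le[OF less.prems] by linarith
    qed
  qed
  have "lex_on {..<l} w (rot l u w) \<longleftrightarrow> lex_on {..<l} z (rot l u z)"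
    by (rule lex_on_cong) (simp_all add: eq rot_s s_less)
  then have "\<forall>r<l. w r = rot l u w r"
    using z(2) nots by (auto simp: lex_on_def)
  then show False
    using neg ju by auto
qed

text \<open>If the greedy word \<open>w\<close> ties with some rotation, \<open>w'\<close> lowers
  its entry at \<open>f\<close> to 0. For a shift \<open>t <= f\<close> the lowered entry sits at
  position \<open>f - t\<close> of the rotation, where \<open>w'\<close> still has 1 unless the
  comparison was decided before. For \<open>t > f\<close> the word \<open>w\<close> is strictly
  larger, and a tying shift \<open>p <= f\<close> is a period that brings the deciding position
  before \<open>f\<close>, where \<open>w'\<close> agrees with \<open>w\<close>.\<close>

lemma aperiodic_word_exists:
  assumes U: "U \<subseteq> {0<..<l}" "\<And>u. u \<in> U \<Longrightarrow> l - u \<in> U" and dis: "A0 \<inter> A1 = {}"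
    and free: "\<not> {..<l} \<subseteq> A0 \<union> A1"
    and unf: "\<And>u. u \<in> U \<Longrightarrow> unforced l A0 A1 u"
  shows "\<exists>v. fits l A0 A1 v \<and> (\<forall>u\<in>U. slex_on {..<l} v (rot l u v))"
proof -
  define f where "f = (LEAST r. r < l \<and> r \<notin> A0 \<union> A1)"
  have "\<exists>r. r < l \<and> r \<notin> A0 \<union> A1"
    using free by auto
  then have f: "f < l" "f \<notin> A0 \<union> A1"
    unfolding f_def by (rule LeastI2_ex, blast)+
  have f': "r \<in> A0 \<union> A1" if "r < f" for r
    using not_less_Least[of r "\<lambda>r. r < l \<and> r \<notin> A0 \<union> A1"] that f(1) unfolding f_def by auto
  define w where "w r = (if r \<in> insert f A1 then 1 else (0::real))" for r
  have w_fits: "fits l A0 A1 w"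
    using f dis by (auto simp: fits_def w_def)
  have dich: "slex_on {..<l} w (rot l u w) \<or> u \<le> f \<and> (\<forall>r<l. w r = rot l u w r)" if "u \<in> U" for u
  proof -
    have "0 < u" "u < l" using that U(1) by auto
    from min_word_lex_or_periodic[OF this dis f f' unf[OF that], folded w_def] show ?thesis .
  qed
  define P where "P = {u \<in> U. \<not> slex_on {..<l} w (rot l u w)}"
  show ?thesis
  proof (cases "P = {}")
    case True
    then show ?thesis using w_fits by (auto simp: P_def)
  next
    case False
    define p where "p = Min P"
    have "finite P"
      using finite_subset[OF U(1)] by (simp add: P_def)
    then have p: "p \<in> P" "\<And>u. u \<in> P \<Longrightarrow> p \<le> u"
      using False by (auto simp: p_def)
    have pU: "p \<in> U" "0 < p" "p < l"
      using p U(1) by (auto simp: P_def)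
    have Pd: "u \<le> f \<and> (\<forall>r<l. w r = rot l u w r)" if "u \<in> P" for u
      using dich[of u] that unfolding P_def by blast
    have per: "w ((r + p) mod l) = w r" if "r < l" for r
      using Pd[OF p(1)] that unfolding rot_def by metis
    have "\<not> slex_on {..<l} w (rot l (l - p) w)"
    proof
      assume "slex_on {..<l} w (rot l (l - p) w)"
      moreover have "rot l (l - p) w r = w r" if "r < l" for r
      proof -
        have "((r + (l - p)) mod l + p) mod l = r"
          using that pU by (simp add: mod_add_left_eq)
        then show ?thesis
          using per[of "(r + (l - p)) mod l"] that by (simp add: rot_def)
      qed
      ultimately show False
        unfolding slex_on_def by auto
    qed
    then have lp: "l - p \<in> P"
      using U(2)[OF pU(1)] by (simp add: P_def)
    then have lpf: "l - p \<le> f" and pf: "p \<le> f"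
      using Pd p(1) by blast+
    define w' where "w' = w(f := 0)"
    have w'_le: "w' r \<le> w r" for r
      by (simp add: w'_def w_def)
    have "fits l A0 A1 w'"
      using w_fits f by (auto simp: fits_def w'_def)
    moreover have "slex_on {..<l} w' (rot l t w')" if t: "t \<in> U" for t
    proof (cases "t \<le> f")
      case True
      have lex: "lex_on {..<l} w (rot l t w)"
        using dich[OF t] unfolding lex_on_def by blast
      have t0: "0 < t" using t U by auto
      have below: "rot l t w' i = rot l t w i" "w' i = w i" if "i < f - t" for i
        using that True f(1) by (auto simp: rot_def w'_def)
      have at: "rot l t w' (f - t) = 0" "w' (f - t) = w (f - t)" "rot l t w (f - t) = 1"
        using True f(1) t0 by (auto simp: rot_def w'_def w_def)
      have "f - t \<le> l" using f(1) by simp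
      from lex_on_cases_prefix[OF lex this]
      consider "\<forall>i<f - t. w i = rot l t w i"
        | i where "i < f - t" "\<forall>j<i. w j = rot l t w j" "rot l t w i < w i"
        by blast
      then show ?thesis
      proof cases
        case 1
        then have "1 \<le> w (f - t)"
          using lex_on_leD[OF lex, of "f - t"] at f(1) by auto
        with 1 show ?thesis
          using slex_onI[of "f - t" l w'] below at f(1) by auto
      next
        case (2 i)
        then show ?thesis
          using slex_onI[of i l w'] below f(1) by auto
      qed
    next
      case False
      then have "slex_on {..<l} w (rot l t w)"
        using dich[OF t] by blast
      then obtain q0 where q0: "q0 < l" "\<And>i. i < q0 \<Longrightarrow> w i = rot l t w i" "rot l t w q0 < w q0"
        unfolding slex_on_def by auto
      \<comment> \<open>By periodicity, a difference at or after \<open>f\<close> would recur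
        \<open>p\<close> places earlier, so it could not be the first one.\<close>
      have "q0 < f"
      proof (rule ccontr)
        assume "\<not> q0 < f"
        then have "q0 = (q0 - p + p) mod l" "q0 - p < q0"
          using q0(1) pf pU by auto
        moreover have "(q0 + t) mod l = ((q0 - p + t) mod l + p) mod l"
          using \<open>\<not> q0 < f\<close> pf by (simp add: mod_add_left_eq)
        ultimately have "w q0 = w (q0 - p)" "rot l t w q0 = rot l t w (q0 - p)"
          using per[of "q0 - p"] per[of "(q0 - p + t) mod l"] q0(1)
          unfolding rot_def by fastforce+
        then show False
          using q0 \<open>q0 - p < q0\<close> by fastforce
      qed
      then have w'q: "w' i = w i" if "i \<le> q0" for i
        using that by (simp add: w'_def)
      have le: "rot l t w' i \<le> rot l t w i" for i
        using w'_le by (simp add: rot_def)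
      \<comment> \<open>Lowering \<open>f\<close> may also lower the rotation before
        \<open>q0\<close> and decide the comparison there, so the first strict position is chosen
        anew.\<close>
      define q where "q = (LEAST i. rot l t w' i < w' i)"
      have ex: "rot l t w' q0 < w' q0"
        using q0(3) le[of q0] w'q by auto
      then have q: "rot l t w' q < w' q" "q \<le> q0"
        unfolding q_def by (auto intro: LeastI Least_le)
      have "w' i = rot l t w' i" if "i < q" for i
        using not_less_Least[of i "\<lambda>i. rot l t w' i < w' i"] that q(2) q0(2)[of i] le[of i] w'q[of i]
        unfolding q_def by linarith
      then show ?thesis
        using q q0(1) by (intro slex_onI[of q]) auto
    qed
    ultimately show ?thesis by blast
  qed
qed

subsection \<open>Symmetry constraints on consecutive blocks\<close>

lemma cube_values: "x \<in> cube n \<Longrightarrow> i \<in> {1..n} \<Longrightarrow> x i = 0 \<or> x i = 1"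
  by (auto simp: cube_def PiE_def Pi_def)

lemma cube_upd:
  assumes "x \<in> cube n" "A \<subseteq> {1..n}" "\<And>i. i \<in> A \<Longrightarrow> v i \<in> {0, 1}"
  shows "(\<lambda>i. if i \<in> A then v i else x i) \<in> cube n"
  using assms by (auto simp: cube_def PiE_def Pi_def extensional_def)

lemma face_mono: "I0 \<subseteq> J0 \<Longrightarrow> I1 \<subseteq> J1 \<Longrightarrow> face n J0 J1 \<subseteq> face n I0 I1"
  by (auto simp: face_def)

lemma face_nonempty:
  assumes "J0 \<inter> J1 = {}" "J0 \<subseteq> {1..n}" "J1 \<subseteq> {1..n}"
  shows "face n J0 J1 \<noteq> {}"
proof -
  have "(\<lambda>i. if i \<in> {1..n} then if i \<in> J1 then 1 else 0 else undefined) \<in> face n J0 J1"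
    using assms by (auto simp: face_def cube_def split: if_splits)
  then show ?thesis by blast
qed

locale block_order =
  fixes n m :: nat and N :: "nat \<Rightarrow> nat set" and a :: "nat \<Rightarrow> nat"
  assumes a_1: "a 1 = 1" and a_Suc_m: "a (Suc m) = Suc n"
    and N_eq: "c \<in> {1..m} \<Longrightarrow> N c = {a c..<a (Suc c)}"
    and a_less: "c \<in> {1..m} \<Longrightarrow> a c < a (Suc c)"
begin

definition len :: "nat \<Rightarrow> nat" where
  "len c = a (Suc c) - a c"

lemma N_shift: "c \<in> {1..m} \<Longrightarrow> N c = {a c..<a c + len c}"
  using N_eq a_less by (simp add: len_def less_imp_le)

lemma N_nth: "c \<in> {1..m} \<Longrightarrow> i \<in> N c \<longleftrightarrow> (\<exists>r<len c. i = a c + r)"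
  unfolding N_shift by (auto simp: le_iff_add)

lemma a_mono: "c \<le> d \<Longrightarrow> 1 \<le> c \<Longrightarrow> d \<le> Suc m \<Longrightarrow> a c \<le> a d"
proof (induction d rule: dec_induct)
  case (step d)
  then show ?case using a_less[of d] by force
qed simp

lemma a_bounds: "c \<in> {1..Suc m} \<Longrightarrow> 1 \<le> a c \<and> a c \<le> Suc n"
  using a_mono[of 1 c] a_mono[of c "Suc m"] a_1 a_Suc_m by auto

lemma N_subset: "c \<in> {1..m} \<Longrightarrow> N c \<subseteq> {1..n}"
  using a_bounds[of c] a_bounds[of "Suc c"] N_eq by auto

lemma finite_N: "c \<in> {1..m} \<Longrightarrow> finite (N c)"
  using N_eq by simp

lemma tail_split:
  assumes "c \<in> {1..m}"
  shows "{a c..n} = N c \<union> {a (Suc c)..n}"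
proof -
  have "a (Suc c) \<le> Suc n"
    using a_bounds[of "Suc c"] assms by simp
  then show ?thesis
    using a_less[OF assms] unfolding N_eq[OF assms] by auto
qed

lemma N_before_tail: "c \<in> {1..m} \<Longrightarrow> i \<in> N c \<Longrightarrow> j \<in> {a (Suc c)..n} \<Longrightarrow> i < j"
  using N_eq by auto

section \<open>Block rotations and the subproblems of the loop\<close>

definition block_rotation :: "(nat \<Rightarrow> nat) \<Rightarrow> bool" where
  "block_rotation \<pi> \<longleftrightarrow> \<pi> permutes {1..n} \<and>
     (\<forall>c\<in>{1..m}. \<exists>u<len c. \<forall>r<len c. \<pi> (a c + r) = a c + (r + u) mod len c)"

text \<open>The invariant carried by the groups of the loop; both kinds of stabilizer inherit it.
  Inverses matter because stabilizers are defined through \<pi> while \<open>perm_act\<close> uses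
  \<open>inv' \<pi>\<close>.\<close>

definition inverse_closed :: "(nat \<Rightarrow> nat) set \<Rightarrow> bool" where
  "inverse_closed \<Delta> \<longleftrightarrow> (\<forall>\<pi>\<in>\<Delta>. block_rotation \<pi> \<and> inv' \<pi> \<in> \<Delta>)"

text \<open>The solution set for the iterations from \<open>c\<close> on. Entries before block
  \<open>c\<close> remain free coordinates of the cube, so that all these sets live in one space and
  can be intersected with the same faces.\<close>

definition tail :: "nat \<Rightarrow> (nat \<Rightarrow> nat) set \<Rightarrow> (nat \<Rightarrow> real) set" where
  "tail c \<Delta> = {x \<in> cube n. \<forall>\<pi>\<in>\<Delta>. lex_on {a c..n} x (perm_act \<pi> x)}"

lemma inverse_closedD:
  assumes "inverse_closed \<Delta>" "\<pi> \<in> \<Delta>"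
  shows "\<pi> permutes {1..n}" "block_rotation \<pi>" "inv' \<pi> \<in> \<Delta>"
    "inv' \<pi> permutes {1..n}" "block_rotation (inv' \<pi>)"
    "\<pi> (inv' \<pi> i) = i" "inv' \<pi> (\<pi> i) = i"
  using assms unfolding inverse_closed_def block_rotation_def
  by (auto simp: permutes_inverses)

lemma block_rotation_N:
  assumes "block_rotation \<pi>" "c \<in> {1..m}" "i \<in> N c"
  shows "\<pi> i \<in> N c"
proof -
  obtain u where u: "\<forall>r<len c. \<pi> (a c + r) = a c + (r + u) mod len c"
    using assms unfolding block_rotation_def by blast
  obtain r where "r < len c" "i = a c + r"
    using assms N_nth by auto
  then show ?thesis
    using u assms(2) N_nth by auto
qed

lemma inv_N:
  assumes "inverse_closed \<Delta>" "\<pi> \<in> \<Delta>" "c \<in> {1..m}"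
  shows "inv' \<pi> i \<in> N c \<longleftrightarrow> i \<in> N c"
  using assms block_rotation_N inverse_closedD by metis

lemma inv_tail:
  assumes "inverse_closed \<Delta>" "\<pi> \<in> \<Delta>" "1 \<le> c" "c \<le> Suc m" "i \<in> {a c..n}"
  shows "inv' \<pi> i \<in> {a c..n}"
  using assms(4,3,5)
proof (induction c rule: inc_induct)
  case base
  then show ?case using a_Suc_m by simp
next
  case (step c)
  then have "c \<in> {1..m}" by simp
  then show ?case
    using step inv_N[OF assms(1,2) \<open>c \<in> {1..m}\<close>] tail_split[of c] by auto
qed

lemma perm_act_restr:
  assumes "inverse_closed \<Delta>" "\<pi> \<in> \<Delta>" "c \<in> {1..m}"
  shows "perm_act (restr \<pi> (N c)) x i = (if i \<in> N c then perm_act \<pi> x i else x i)"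
proof -
  have "inv' (restr \<pi> (N c)) = (\<lambda>i. if i \<in> N c then inv' \<pi> i else i)"
    using inv_N[OF assms] inverse_closedD[OF assms(1,2)]
      block_rotation_N[OF _ assms(3)]
    by (intro inv_equality) (auto simp: restr_def)
  then show ?thesis
    by (simp add: perm_act_def)
qed

lemma symre_restr:
  assumes "inverse_closed \<Delta>" "\<pi> \<in> \<Delta>" "c \<in> {1..m}"
  shows "symre n (restr \<pi> (N c)) = {x \<in> cube n. lex_on (N c) x (perm_act \<pi> x)}"
proof -
  have "lex_geq n x (perm_act (restr \<pi> (N c)) x) \<longleftrightarrow> lex_on (N c) x (perm_act \<pi> x)" for x
  proof -
    have "lex_geq n x (perm_act (restr \<pi> (N c)) x) \<longleftrightarrow>
        lex_on (N c) x (perm_act (restr \<pi> (N c)) x)"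
      unfolding lex_geq_iff_lex_on
      by (rule lex_on_superset) (use N_subset[OF assms(3)] perm_act_restr[OF assms] in auto)
    also have "\<dots> \<longleftrightarrow> lex_on (N c) x (perm_act \<pi> x)"
      by (rule lex_on_cong) (auto simp: perm_act_restr[OF assms])
    finally show ?thesis .
  qed
  then show ?thesis by (simp add: symre_def)
qed

text \<open>What a successful individual propagation guarantees on the block. It is a property of
  the fixings and not of a run, because it has to hold again after probing has enlarged
  them.\<close>

definition individually_complete :: "nat \<Rightarrow> (nat \<Rightarrow> nat) set \<Rightarrow> nat set \<Rightarrow> nat set \<Rightarrow> bool" where
  "individually_complete c \<Delta> J0 J1 \<longleftrightarrow> \<not> detects_infeasible n (restr_set \<Delta> (N c)) J0 J1 \<and>
     (\<forall>i\<in>N c - (J0 \<union> J1). \<forall>\<pi>\<in>restr_set \<Delta> (N c). \<forall>b\<in>{0, 1}. \<not> valid_fixing n \<pi> J0 J1 i b)"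

lemma symre_word:
  assumes "inverse_closed \<Delta>" "\<pi> \<in> \<Delta>" "c \<in> {1..m}"
    and u: "\<forall>r<len c. inv' \<pi> (a c + r) = a c + (r + u) mod len c"
  shows "lex_on (N c) x (perm_act \<pi> x) \<longleftrightarrow>
      lex_on {..<len c} (\<lambda>r. x (a c + r)) (rot (len c) u (\<lambda>r. x (a c + r)))"
    "slex_on (N c) x (perm_act \<pi> x) \<longleftrightarrow>
      slex_on {..<len c} (\<lambda>r. x (a c + r)) (rot (len c) u (\<lambda>r. x (a c + r)))"
  unfolding N_shift[OF assms(3)] lex_on_shift slex_on_shift
  by (rule lex_on_cong slex_on_cong; simp add: perm_act_def rot_def u)+

text \<open>Transfers the word lemma to a block: \<open>U\<close> collects the nonzero shifts by
  which inverses of members of \<Delta> act there. A permutation of shift 0 fixes the block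
  pointwise, which is the other alternative in the conclusion.\<close>

lemma strict_block_exists:
  assumes \<Delta>: "inverse_closed \<Delta>" and c: "c \<in> {1..m}" and compl: "individually_complete c \<Delta> J0 J1"
    and dis: "J0 \<inter> J1 = {}" and free: "\<not> N c \<subseteq> J0 \<union> J1"
  shows "\<exists>x. (\<forall>i\<in>N c. x i \<in> {0, 1} \<and> (i \<in> J0 \<longrightarrow> x i = 0) \<and> (i \<in> J1 \<longrightarrow> x i = 1)) \<and>
    (\<forall>\<pi>\<in>\<Delta>. (\<forall>i\<in>N c. \<pi> i = i) \<or> slex_on (N c) x (perm_act \<pi> x))"
proof -
  let ?l = "len c"
  define A where "A J = {r. r < ?l \<and> a c + r \<in> J}" for J
  define shift where "shift \<pi> u \<longleftrightarrow> (\<forall>r<?l. inv' \<pi> (a c + r) = a c + (r + u) mod ?l)" for \<pi> u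
  define U where "U = {u \<in> {0<..<?l}. \<exists>\<pi>\<in>\<Delta>. shift \<pi> u}"
  have "A J0 \<inter> A J1 = {}"
    using dis by (auto simp: A_def)
  moreover have "\<not> {..<?l} \<subseteq> A J0 \<union> A J1"
    using free N_nth[OF c] by (auto simp: A_def)
  moreover have "U \<subseteq> {0<..<?l}"
    by (auto simp: U_def)
  moreover have "?l - u \<in> U" if "u \<in> U" for u
  proof -
    from that obtain \<pi> where \<pi>: "\<pi> \<in> \<Delta>" "shift \<pi> u" "0 < u" "u < ?l"
      by (auto simp: U_def)
    have "inv' (inv' \<pi>) (a c + r) = a c + (r + (?l - u)) mod ?l" if "r < ?l" for r
    proof -
      have "inv' \<pi> (a c + (r + (?l - u)) mod ?l) = a c + r"
        using \<pi> that by (simp add: shift_def mod_add_left_eq)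
      then show ?thesis
        using inverse_closedD[OF \<Delta> \<pi>(1)] inverse_closedD(7)[OF \<Delta> inverse_closedD(3)[OF \<Delta> \<pi>(1)]]
        by metis
    qed
    then show ?thesis
      using \<pi> inverse_closedD(3)[OF \<Delta> \<pi>(1)] by (auto simp: U_def shift_def)
  qed
  moreover have "unforced ?l (A J0) (A J1) u" if "u \<in> U" for u
    unfolding unforced_def
  proof (intro allI impI ballI)
    fix r b assume r: "r < ?l" "r \<notin> A J0 \<union> A J1" and b: "b \<in> {0, 1::real}"
    from that obtain \<pi> where \<pi>: "\<pi> \<in> \<Delta>" "shift \<pi> u"
      by (auto simp: U_def)
    have i: "a c + r \<in> N c - (J0 \<union> J1)"
      using r N_nth[OF c] by (auto simp: A_def)
    \<comment> \<open>The value \<open>b\<close> is attained because the opposite fixing is not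
      valid.\<close>
    have "1 - b \<in> {0, 1}" using b by auto
    then have "\<not> valid_fixing n (restr \<pi> (N c)) J0 J1 (a c + r) (1 - b)"
      using compl i \<pi>(1) unfolding individually_complete_def restr_set_def by blast
    then obtain x where x: "x \<in> symre n (restr \<pi> (N c))" "x \<in> face n J0 J1" "x (a c + r) \<noteq> 1 - b"
      unfolding valid_fixing_def by blast
    have cube: "x \<in> cube n" using x by (simp add: face_def)
    have "x (a c + r) = b"
      using x(3) b cube_values[OF cube, of "a c + r"] i N_subset[OF c] by auto
    moreover have "fits ?l (A J0) (A J1) (\<lambda>r. x (a c + r))"
      unfolding fits_def
    proof (intro allI impI conjI)
      fix r' assume r': "r' < ?l"
      then have "a c + r' \<in> {1..n}"
        using N_subset[OF c] N_nth[OF c] by blast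
      then show "x (a c + r') \<in> {0, 1}"
        using cube_values[OF cube] by simp
    qed (use x(2) in \<open>auto simp: A_def face_def\<close>)
    moreover have "lex_on {..<?l} (\<lambda>r. x (a c + r)) (rot ?l u (\<lambda>r. x (a c + r)))"
      using x(1) symre_restr[OF \<Delta> \<pi>(1) c] symre_word[OF \<Delta> \<pi>(1) c \<pi>(2)[unfolded shift_def]] by simp
    ultimately show "\<exists>v. fits ?l (A J0) (A J1) v \<and> lex_on {..<?l} v (rot ?l u v) \<and> v r = b"
      by (intro exI[of _ "\<lambda>r. x (a c + r)"]) simp
  qed
  ultimately obtain v where v: "fits ?l (A J0) (A J1) v" "\<forall>u\<in>U. slex_on {..<?l} v (rot ?l u v)"
    using aperiodic_word_exists[of U ?l "A J0" "A J1"] by blast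
  define x where "x i = v (i - a c)" for i
  have "x i \<in> {0, 1} \<and> (i \<in> J0 \<longrightarrow> x i = 0) \<and> (i \<in> J1 \<longrightarrow> x i = 1)" if "i \<in> N c" for i
    using that v(1) N_nth[OF c] unfolding fits_def A_def x_def by auto
  moreover have "(\<forall>i\<in>N c. \<pi> i = i) \<or> slex_on (N c) x (perm_act \<pi> x)" if \<pi>: "\<pi> \<in> \<Delta>" for \<pi>
  proof -
    obtain u where u: "u < ?l" "shift \<pi> u"
      using inverse_closedD(5)[OF \<Delta> \<pi>] c unfolding block_rotation_def shift_def by blast
    show ?thesis
    proof (cases "u = 0")
      case True
      then have "inv' \<pi> i = i" if "i \<in> N c" for i
        using u(2) that N_nth[OF c] by (auto simp: shift_def)
      then show ?thesis
        using inverse_closedD(6)[OF \<Delta> \<pi>] by metis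
    next
      case False
      then have "slex_on {..<?l} v (rot ?l u v)"
        using v(2) u \<pi> by (auto simp: U_def)
      then show ?thesis
        using symre_word(2)[OF \<Delta> \<pi> c u(2)[unfolded shift_def], of x] by (simp add: x_def)
    qed
  qed
  ultimately show ?thesis by blast
qed

section \<open>Passing from one block to the next\<close>

lemma tail_mono: "\<Delta>' \<subseteq> \<Delta> \<Longrightarrow> tail c \<Delta> \<subseteq> tail c \<Delta>'"
  by (auto simp: tail_def)

lemma lex_on_tail_step:
  assumes "c \<in> {1..m}"
  shows "lex_on {a c..n} x y \<longleftrightarrow> slex_on (N c) x y \<or> (\<forall>i\<in>N c. x i = y i) \<and> lex_on {a (Suc c)..n} x y"
  unfolding tail_split[OF assms] by (rule lex_on_Un) (rule N_before_tail[OF assms])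

lemma tail_subset_symre:
  assumes "inverse_closed \<Delta>" "c \<in> {1..m}" "\<pi> \<in> restr_set \<Delta> (N c)"
  shows "tail c \<Delta> \<subseteq> symre n \<pi>"
proof
  fix x assume x: "x \<in> tail c \<Delta>"
  obtain \<rho> where \<rho>: "\<rho> \<in> \<Delta>" "\<pi> = restr \<rho> (N c)"
    using assms(3) by (auto simp: restr_set_def)
  then have "lex_on (N c) x (perm_act \<rho> x)"
    using x lex_on_tail_step[OF assms(2), of x "perm_act \<rho> x"] by (auto simp: tail_def lex_on_def)
  then show "x \<in> symre n \<pi>"
    using x symre_restr[OF assms(1) \<rho>(1) assms(2)] \<rho>(2) by (simp add: tail_def)
qed

lemma inverse_closed_pointwise_stab:
  assumes "inverse_closed \<Delta>"
  shows "inverse_closed (pointwise_stab I \<Delta>)"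
proof -
  have "inv' \<pi> i = i" if "\<pi> \<in> \<Delta>" "\<pi> i = i" for \<pi> i
    using inverse_closedD(7)[OF assms that(1), of i] that(2) by simp
  then show ?thesis
    using assms unfolding inverse_closed_def pointwise_stab_def by simp
qed

text \<open>\<open>setwise_stab\<close> only asks that \<pi> map \<open>I\<close> into
  \<open>I\<close>. On a finite set injectivity turns this into equality, which passes to the
  inverse.\<close>

lemma inverse_closed_setwise_stab:
  assumes "inverse_closed \<Delta>" "finite I"
  shows "inverse_closed (setwise_stab I \<Delta>)"
proof -
  have "inv' \<pi> i \<in> I" if \<pi>: "\<pi> \<in> \<Delta>" "\<forall>i\<in>I. \<pi> i \<in> I" and i: "i \<in> I" for \<pi> i
  proof -
    have "inj_on \<pi> I"
      using inverse_closedD(1)[OF assms(1) \<pi>(1)] permutes_inj_on by blast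
    moreover have "\<pi> ` I \<subseteq> I" using \<pi>(2) by blast
    ultimately have "\<pi> ` I = I"
      using assms(2) endo_inj_surj by blast
    with i obtain j where "j \<in> I" "i = \<pi> j" by blast
    then show ?thesis using inverse_closedD(7)[OF assms(1) \<pi>(1)] by simp
  qed
  then show ?thesis
    using inverse_closedD[OF assms(1)] unfolding inverse_closed_def setwise_stab_def by blast
qed

lemma inverse_closed_next_group:
  assumes "inverse_closed \<Delta>" "c \<in> {1..m}"
  shows "inverse_closed (next_group (N c) \<Delta> J0 J1)"
proof -
  have "inverse_closed (setwise_stab (J \<inter> N c) \<Delta>)" for J
    using assms finite_N inverse_closed_setwise_stab by blast
  then have "inverse_closed (setwise_stab (J0 \<inter> N c) \<Delta> \<inter> setwise_stab (J1 \<inter> N c) \<Delta>)"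
    unfolding inverse_closed_def by blast
  then show ?thesis
    using inverse_closed_pointwise_stab[OF assms(1)] by (simp add: next_group_def)
qed

lemma pointwise_stab_subset_next_group: "pointwise_stab (N c) \<Delta> \<subseteq> next_group (N c) \<Delta> J0 J1"
  by (auto simp: next_group_def pointwise_stab_def setwise_stab_def)

lemma tail_subset_tail_pointwise_stab:
  assumes "inverse_closed \<Delta>" "c \<in> {1..m}"
  shows "tail c \<Delta> \<subseteq> tail (Suc c) (pointwise_stab (N c) \<Delta>)"
proof -
  have "lex_on {a (Suc c)..n} x (perm_act \<pi> x)"
    if x: "x \<in> tail c \<Delta>" and \<pi>: "\<pi> \<in> \<Delta>" "\<forall>i\<in>N c. \<pi> i = i" for x \<pi>
  proof -
    have "perm_act \<pi> x i = x i" if "i \<in> N c" for i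
      using inverse_closedD(7)[OF assms(1) \<pi>(1)] \<pi>(2) that unfolding perm_act_def by metis
    then have "\<not> slex_on (N c) x (perm_act \<pi> x)"
      by (auto simp: slex_on_def)
    then show ?thesis
      using x \<pi>(1) lex_on_tail_step[OF assms(2), of x "perm_act \<pi> x"] by (auto simp: tail_def)
  qed
  then show ?thesis
    by (auto simp: tail_def pointwise_stab_def)
qed

text \<open>The block of \<open>y\<close> is overwritten by the strict word. This settles every
  \<pi> that moves the block; a \<pi> that fixes it maps the later positions among themselves, where
  \<open>y\<close> is unchanged and satisfies the comparison.\<close>

lemma tail_extend:
  assumes \<Delta>: "inverse_closed \<Delta>" and c: "c \<in> {1..m}" and compl: "individually_complete c \<Delta> J0 J1"
    and dis: "J0 \<inter> J1 = {}" and free: "\<not> N c \<subseteq> J0 \<union> J1"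
    and y: "y \<in> tail (Suc c) (pointwise_stab (N c) \<Delta>) \<inter> face n J0 J1"
  shows "\<exists>x \<in> tail c \<Delta> \<inter> face n J0 J1. \<forall>i. i \<notin> N c \<longrightarrow> x i = y i"
proof -
  obtain v where v: "\<forall>i\<in>N c. v i \<in> {0, 1} \<and> (i \<in> J0 \<longrightarrow> v i = 0) \<and> (i \<in> J1 \<longrightarrow> v i = 1)"
    and strict: "\<forall>\<pi>\<in>\<Delta>. (\<forall>i\<in>N c. \<pi> i = i) \<or> slex_on (N c) v (perm_act \<pi> v)"
    using strict_block_exists[OF \<Delta> c compl dis free] by blast
  define x where "x = (\<lambda>i. if i \<in> N c then v i else y i)"
  have xN: "x i = v i" if "i \<in> N c" for i
    using that by (simp add: x_def)
  have xt: "x i = y i" if "i \<in> {a (Suc c)..n}" for i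
    using that N_before_tail[OF c, of i i] by (auto simp: x_def)
  have cube: "x \<in> cube n"
    unfolding x_def using y v N_subset[OF c] by (intro cube_upd) (auto simp: face_def)
  have "x \<in> face n J0 J1"
    using cube y v by (auto simp: face_def x_def)
  moreover have "lex_on {a c..n} x (perm_act \<pi> x)" if \<pi>: "\<pi> \<in> \<Delta>" for \<pi>
  proof (cases "\<forall>i\<in>N c. \<pi> i = i")
    case True
    then have "x i = perm_act \<pi> x i" if "i \<in> N c" for i
      using inverse_closedD(7)[OF \<Delta> \<pi>] that unfolding perm_act_def by metis
    moreover have "lex_on {a (Suc c)..n} y (perm_act \<pi> y)"
      using y True \<pi> by (auto simp: tail_def pointwise_stab_def)
    moreover have "lex_on {a (Suc c)..n} x (perm_act \<pi> x) \<longleftrightarrow> lex_on {a (Suc c)..n} y (perm_act \<pi> y)"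
      using xt inv_tail[OF \<Delta> \<pi>, of "Suc c"] c unfolding perm_act_def by (intro lex_on_cong) auto
    ultimately show ?thesis
      using lex_on_tail_step[OF c] by blast
  next
    case False
    then have "slex_on (N c) v (perm_act \<pi> v)"
      using strict \<pi> by blast
    moreover have "slex_on (N c) x (perm_act \<pi> x) \<longleftrightarrow> slex_on (N c) v (perm_act \<pi> v)"
      using xN inv_N[OF \<Delta> \<pi> c] unfolding perm_act_def by (intro slex_on_cong) auto
    ultimately show ?thesis
      using lex_on_tail_step[OF c] by blast
  qed
  ultimately show ?thesis
    using cube by (intro bexI[of _ x]) (auto simp: tail_def x_def)
qed

text \<open>The face determines the point on the whole block, so feasibility of each single
  constraint already puts every comparison on the block in order. It is a tie exactly when \<pi>
  maps zeros to zeros and ones to ones; all other comparisons are decided there.\<close>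

lemma tail_step_fixed:
  assumes \<Delta>: "inverse_closed \<Delta>" and c: "c \<in> {1..m}"
    and feas: "\<not> detects_infeasible n (restr_set \<Delta> (N c)) J0 J1"
    and dis: "J0 \<inter> J1 = {}" and full: "N c \<subseteq> J0 \<union> J1"
  shows "tail c \<Delta> \<inter> face n J0 J1 = tail (Suc c) (next_group (N c) \<Delta> J0 J1) \<inter> face n J0 J1"
proof -
  define S where "S = setwise_stab (J0 \<inter> N c) \<Delta> \<inter> setwise_stab (J1 \<inter> N c) \<Delta>"
  have S: "next_group (N c) \<Delta> J0 J1 = S"
    using full by (simp add: next_group_def S_def)
  have clS: "inverse_closed S"
    using inverse_closed_next_group[OF \<Delta> c, of J0 J1] S by simp
  have "x \<in> tail c \<Delta> \<longleftrightarrow> x \<in> tail (Suc c) S" if x: "x \<in> face n J0 J1" for x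
  proof -
    have x01: "i \<in> J0 \<Longrightarrow> x i = 0" "i \<in> J1 \<Longrightarrow> x i = 1" for i
      using x by (auto simp: face_def)
    have stab: "\<pi> \<in> S \<longleftrightarrow> (\<forall>i\<in>N c. x i = perm_act \<pi> x i)" if \<pi>: "\<pi> \<in> \<Delta>" for \<pi>
    proof
      assume "\<pi> \<in> S"
      then have "inv' \<pi> \<in> S" using clS inverse_closedD by blast
      then show "\<forall>i\<in>N c. x i = perm_act \<pi> x i"
      proof (intro ballI)
        fix i assume i: "i \<in> N c"
        then consider "i \<in> J0" | "i \<in> J1" using full by blast
        then show "x i = perm_act \<pi> x i"
        proof cases
          case 1
          then have "inv' \<pi> i \<in> J0"
            using \<open>inv' \<pi> \<in> S\<close> i by (simp add: S_def setwise_stab_def)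
          then show ?thesis using 1 x01 by (simp add: perm_act_def)
        next
          case 2
          then have "inv' \<pi> i \<in> J1"
            using \<open>inv' \<pi> \<in> S\<close> i by (simp add: S_def setwise_stab_def)
          then show ?thesis using 2 x01 by (simp add: perm_act_def)
        qed
      qed
    next
      assume eq: "\<forall>i\<in>N c. x i = perm_act \<pi> x i"
      have "\<pi> i \<in> N c \<and> (i \<in> J0 \<longrightarrow> \<pi> i \<in> J0) \<and> (i \<in> J1 \<longrightarrow> \<pi> i \<in> J1)" if "i \<in> N c" for i
      proof -
        have N: "\<pi> i \<in> N c"
          using block_rotation_N[OF inverse_closedD(2)[OF \<Delta> \<pi>] c that] .
        moreover from this have "x (\<pi> i) = x i"
          using eq inverse_closedD(7)[OF \<Delta> \<pi>, of i] by (simp add: perm_act_def)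
        moreover have "\<pi> i \<in> J0 \<or> \<pi> i \<in> J1"
          using N full by blast
        ultimately show ?thesis
          using x01[of i] x01[of "\<pi> i"] by auto
      qed
      then show "\<pi> \<in> S"
        using \<pi> by (simp add: S_def setwise_stab_def)
    qed
    have strict: "slex_on (N c) x (perm_act \<pi> x) \<or> \<pi> \<in> S" if \<pi>: "\<pi> \<in> \<Delta>" for \<pi>
    proof -
      \<comment> \<open>Every feasible point for \<pi> agrees with \<open>x\<close> on the fixed
        block, so its comparison there is that of \<open>x\<close>.\<close>
      obtain z where z: "z \<in> symre n (restr \<pi> (N c))" "z \<in> face n J0 J1"
        using feas \<pi> unfolding detects_infeasible_def restr_set_def by blast
      have zx: "z i = x i" if "i \<in> N c" for i
        using full that z(2) x by (auto simp: face_def)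
      have "lex_on (N c) z (perm_act \<pi> z)"
        using z(1) symre_restr[OF \<Delta> \<pi> c] by simp
      also have "lex_on (N c) z (perm_act \<pi> z) \<longleftrightarrow> lex_on (N c) x (perm_act \<pi> x)"
        using zx inv_N[OF \<Delta> \<pi> c] unfolding perm_act_def by (intro lex_on_cong) auto
      finally show ?thesis
        using stab[OF \<pi>] unfolding lex_on_def by blast
    qed
    have equal: "\<not> slex_on (N c) x (perm_act \<pi> x)" if "\<pi> \<in> S" for \<pi>
    proof -
      have "\<pi> \<in> \<Delta>" using that by (simp add: S_def setwise_stab_def)
      then have "\<forall>i\<in>N c. x i = perm_act \<pi> x i" using stab that by blast
      then show ?thesis by (simp add: slex_on_def)
    qed
    have "S \<subseteq> \<Delta>"
      by (auto simp: S_def setwise_stab_def)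
    show ?thesis
    proof -
      have "lex_on {a c..n} x (perm_act \<pi> x) \<longleftrightarrow> \<pi> \<notin> S \<or> lex_on {a (Suc c)..n} x (perm_act \<pi> x)"
        if "\<pi> \<in> \<Delta>" for \<pi>
        using that strict equal stab[OF that] lex_on_tail_step[OF c, of x "perm_act \<pi> x"] by blast
      then show ?thesis
        using \<open>S \<subseteq> \<Delta>\<close> unfolding tail_def by blast
    qed
  qed
  then show ?thesis unfolding S by blast
qed

lemma tail_Suc_m: "tail (Suc m) \<Delta> = cube n"
  by (auto simp: tail_def a_Suc_m lex_on_def)

end

subsection \<open>Correctness of the procedure\<close>

text \<open>\<open>B\<close> is meant to contain every index on which the constraints in
  \<open>P\<close> depend. An entry outside \<open>B\<close> can be flipped freely, so in a feasible
  state no fixing there is valid and only indices of \<open>B\<close> are added. \<open>X\<close>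
  lies in all the constraints, so a fixing valid for one of them cuts nothing off.\<close>

lemma propagate_individually_invariants:
  assumes "propagate_individually n P J0 J1 r"
    and "\<And>\<pi>. \<pi> \<in> P \<Longrightarrow> X \<subseteq> symre n \<pi>"
    and "\<And>\<pi> i x v. \<pi> \<in> P \<Longrightarrow> i \<in> {1..n} - B \<Longrightarrow> x \<in> symre n \<pi> \<Longrightarrow> v \<in> {0, 1} \<Longrightarrow>
      x(i := v) \<in> symre n \<pi>"
    and "J0 \<inter> J1 = {}" "J0 \<subseteq> {1..n}" "J1 \<subseteq> {1..n}"
  shows "case r of None \<Rightarrow> X \<inter> face n J0 J1 = {}
    | Some (K0, K1) \<Rightarrow> X \<inter> face n K0 K1 = X \<inter> face n J0 J1 \<and> J0 \<subseteq> K0 \<and> J1 \<subseteq> K1 \<and>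
        K0 \<subseteq> J0 \<union> B \<and> K1 \<subseteq> J1 \<union> B \<and> K0 \<inter> K1 = {} \<and> K0 \<subseteq> {1..n} \<and> K1 \<subseteq> {1..n} \<and>
        \<not> detects_infeasible n P K0 K1 \<and>
        (\<forall>i\<in>{1..n} - (K0 \<union> K1). \<forall>\<pi>\<in>P. \<forall>b\<in>{0, 1}. \<not> valid_fixing n \<pi> K0 K1 i b)"
  using assms
proof (induction rule: propagate_individually.induct)
  case (infeasible J0 J1)
  then show ?case by (fastforce simp: detects_infeasible_def)
next
  case (fix_zero J0 J1 i \<pi> r)
  have "i \<in> B"
  proof (rule ccontr)
    assume "i \<notin> B"
    obtain x where x: "x \<in> symre n \<pi>" "x \<in> face n J0 J1"
      using fix_zero.hyps by (auto simp: detects_infeasible_def)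
    \<comment> \<open>The flipped point contradicts the validity of the fixing.\<close>
    have "x(i := 1) \<in> symre n \<pi>"
      by (rule fix_zero.prems(2)) (use fix_zero.hyps x \<open>i \<notin> B\<close> in auto)
    moreover from this have "x(i := 1) \<in> face n J0 J1"
      using x(2) fix_zero.hyps by (auto simp: face_def symre_def)
    ultimately have "(x(i := 1)) i = 0"
      using fix_zero.hyps(5) unfolding valid_fixing_def by blast
    then show False by simp
  qed
  moreover have "X \<inter> face n (J0 \<union> {i}) J1 = X \<inter> face n J0 J1"
  proof -
    have "x i = 0" if "x \<in> X" "x \<in> face n J0 J1" for x
      using that fix_zero.hyps(5) fix_zero.prems(1)[OF fix_zero.hyps(4)]
      unfolding valid_fixing_def by blast
    then show ?thesis by (auto simp: face_def)
  qed
  moreover have "(J0 \<union> {i}) \<inter> J1 = {}" "J0 \<union> {i} \<subseteq> {1..n}"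
    using fix_zero.hyps fix_zero.prems by auto
  ultimately show ?case
    using fix_zero.IH[OF fix_zero.prems(1,2) _ _ fix_zero.prems(5)]
    by (cases r) (simp, clarsimp, blast)
next
  case (fix_one J0 J1 i \<pi> r)
  have "i \<in> B"
  proof (rule ccontr)
    assume "i \<notin> B"
    obtain x where x: "x \<in> symre n \<pi>" "x \<in> face n J0 J1"
      using fix_one.hyps by (auto simp: detects_infeasible_def)
    have "x(i := 0) \<in> symre n \<pi>"
      by (rule fix_one.prems(2)) (use fix_one.hyps x \<open>i \<notin> B\<close> in auto)
    moreover from this have "x(i := 0) \<in> face n J0 J1"
      using x(2) fix_one.hyps by (auto simp: face_def symre_def)
    ultimately have "(x(i := 0)) i = 1"
      using fix_one.hyps(5) unfolding valid_fixing_def by blast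
    then show False by simp
  qed
  moreover have "X \<inter> face n J0 (J1 \<union> {i}) = X \<inter> face n J0 J1"
  proof -
    have "x i = 1" if "x \<in> X" "x \<in> face n J0 J1" for x
      using that fix_one.hyps(5) fix_one.prems(1)[OF fix_one.hyps(4)]
      unfolding valid_fixing_def by blast
    then show ?thesis by (auto simp: face_def)
  qed
  moreover have "J0 \<inter> (J1 \<union> {i}) = {}" "J1 \<union> {i} \<subseteq> {1..n}"
    using fix_one.hyps fix_one.prems by auto
  ultimately show ?case
    using fix_one.IH[OF fix_one.prems(1,2) _ fix_one.prems(4)]
    by (cases r) (simp, clarsimp, blast)
next
  case (stop J0 J1)
  then show ?case by simp
qed

lemma propagate_individually_exists: "\<exists>r. propagate_individually n P J0 J1 r"
proof (induction "card ({1..n} - (J0 \<union> J1))" arbitrary: J0 J1 rule: less_induct)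
  case less
  show ?case
  proof (cases "detects_infeasible n P J0 J1")
    case True
    then show ?thesis by (blast intro: propagate_individually.infeasible)
  next
    case feas: False
    show ?thesis
    proof (cases "\<forall>i\<in>{1..n} - (J0 \<union> J1). \<forall>\<gamma>\<in>P. \<forall>b\<in>{0, 1}. \<not> valid_fixing n \<gamma> J0 J1 i b")
      case True
      then show ?thesis using feas by (blast intro: propagate_individually.stop)
    next
      case False
      then obtain i \<pi> where i: "i \<in> {1..n}" "i \<notin> J0 \<union> J1" and \<pi>: "\<pi> \<in> P"
        and b: "valid_fixing n \<pi> J0 J1 i 0 \<or> valid_fixing n \<pi> J0 J1 i 1"
        by blast
      have "{1..n} - (J0 \<union> {i} \<union> J1) = {1..n} - (J0 \<union> J1) - {i}"
        "{1..n} - (J0 \<union> (J1 \<union> {i})) = {1..n} - (J0 \<union> J1) - {i}"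
        by blast+
      moreover have "card ({1..n} - (J0 \<union> J1) - {i}) < card ({1..n} - (J0 \<union> J1))"
        using i by (intro card_Diff1_less) simp_all
      ultimately obtain r0 r1 where r: "propagate_individually n P (J0 \<union> {i}) J1 r0"
        "propagate_individually n P J0 (J1 \<union> {i}) r1"
        using less[of "J0 \<union> {i}" J1] less[of J0 "J1 \<union> {i}"] by auto
      from b show ?thesis
      proof
        assume "valid_fixing n \<pi> J0 J1 i 0"
        from propagate_individually.fix_zero[OF feas i \<pi> this r(1)] show ?thesis by blast
      next
        assume "valid_fixing n \<pi> J0 J1 i 1"
        from propagate_individually.fix_one[OF feas i \<pi> this r(2)] show ?thesis by blast
      qed
    qed
  qed
qed

section \<open>One iteration of the loop\<close>

context block_order
begin

lemma symre_restr_upd: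
  assumes "inverse_closed \<Delta>" "c \<in> {1..m}" "\<pi> \<in> restr_set \<Delta> (N c)"
    and "i \<in> {1..n} - N c" "x \<in> symre n \<pi>" "v \<in> {0, 1}"
  shows "x(i := v) \<in> symre n \<pi>"
proof -
  obtain \<rho> where \<rho>: "\<rho> \<in> \<Delta>" "\<pi> = restr \<rho> (N c)"
    using assms(3) by (auto simp: restr_set_def)
  have x: "x \<in> cube n" "lex_on (N c) x (perm_act \<rho> x)"
    using assms(5) symre_restr[OF assms(1) \<rho>(1) assms(2)] \<rho>(2) by auto
  have "x(i := v) \<in> cube n"
    using cube_upd[OF x(1), of "{i}" "\<lambda>_. v"] assms(4,6) by (simp add: fun_upd_def if_distrib)
  moreover have "lex_on (N c) (x(i := v)) (perm_act \<rho> (x(i := v))) \<longleftrightarrow> lex_on (N c) x (perm_act \<rho> x)"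
    using assms(4) inv_N[OF assms(1) \<rho>(1) assms(2)]
    unfolding perm_act_def by (intro lex_on_cong) auto
  ultimately show ?thesis
    using x(2) symre_restr[OF assms(1) \<rho>(1) assms(2)] \<rho>(2) by simp
qed

lemma propagate_individually_None:
  assumes "inverse_closed \<Delta>" "c \<in> {1..m}" "J0 \<inter> J1 = {}" "J0 \<subseteq> {1..n}" "J1 \<subseteq> {1..n}"
    and "propagate_individually n (restr_set \<Delta> (N c)) J0 J1 None"
  shows "tail c \<Delta> \<inter> face n J0 J1 = {}"
  using propagate_individually_invariants[where X = "tail c \<Delta>" and B = "N c", OF assms(6)]
    tail_subset_symre[OF assms(1,2)] symre_restr_upd[OF assms(1,2)] assms(3-5) by simp

lemma propagate_individually_Some:
  assumes "inverse_closed \<Delta>" "c \<in> {1..m}" "J0 \<inter> J1 = {}" "J0 \<subseteq> {1..n}" "J1 \<subseteq> {1..n}"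
    and "propagate_individually n (restr_set \<Delta> (N c)) J0 J1 (Some (K0, K1))"
  shows "tail c \<Delta> \<inter> face n K0 K1 = tail c \<Delta> \<inter> face n J0 J1"
    "J0 \<subseteq> K0" "J1 \<subseteq> K1" "K0 \<subseteq> J0 \<union> N c" "K1 \<subseteq> J1 \<union> N c"
    "K0 \<inter> K1 = {}" "K0 \<subseteq> {1..n}" "K1 \<subseteq> {1..n}" "individually_complete c \<Delta> K0 K1"
proof -
  note * = propagate_individually_invariants[where X = "tail c \<Delta>" and B = "N c", OF assms(6)
      tail_subset_symre[OF assms(1,2)] symre_restr_upd[OF assms(1,2)] assms(3-5)]
  show "tail c \<Delta> \<inter> face n K0 K1 = tail c \<Delta> \<inter> face n J0 J1"
    "J0 \<subseteq> K0" "J1 \<subseteq> K1" "K0 \<subseteq> J0 \<union> N c" "K1 \<subseteq> J1 \<union> N c"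
    "K0 \<inter> K1 = {}" "K0 \<subseteq> {1..n}" "K1 \<subseteq> {1..n}"
    using * by simp_all
  show "individually_complete c \<Delta> K0 K1"
    using * N_subset[OF assms(2)] unfolding individually_complete_def by auto
qed

lemma joint_infeasible:
  assumes "inverse_closed \<Delta>" "c \<in> {1..m}"
    and "symretope n (restr_set \<Delta> (N c)) \<inter> face n (K0 \<inter> N c) (K1 \<inter> N c) = {}"
  shows "tail c \<Delta> \<inter> face n K0 K1 = {}"
proof -
  have "tail c \<Delta> \<subseteq> symretope n (restr_set \<Delta> (N c))"
    using tail_subset_symre[OF assms(1,2)] unfolding symretope_def by blast
  moreover have "face n K0 K1 \<subseteq> face n (K0 \<inter> N c) (K1 \<inter> N c)"
    by (rule face_mono) auto
  ultimately show ?thesis using assms(3) by blast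
qed

lemma tail_step_subset:
  assumes "inverse_closed \<Delta>" "c \<in> {1..m}" "individually_complete c \<Delta> J0 J1" "J0 \<inter> J1 = {}"
  shows "tail c \<Delta> \<inter> face n J0 J1 \<subseteq> tail (Suc c) (next_group (N c) \<Delta> J0 J1) \<inter> face n J0 J1"
proof (cases "N c \<subseteq> J0 \<union> J1")
  case True
  then show ?thesis
    using tail_step_fixed[OF assms(1,2) _ assms(4)] assms(3) by (simp add: individually_complete_def)
next
  case False
  then show ?thesis
    using tail_subset_tail_pointwise_stab[OF assms(1,2)] by (auto simp: next_group_def)
qed

lemma tail_step_extend:
  assumes "inverse_closed \<Delta>" "c \<in> {1..m}" "individually_complete c \<Delta> J0 J1" "J0 \<inter> J1 = {}"
    and "y \<in> tail (Suc c) (next_group (N c) \<Delta> J0 J1) \<inter> face n J0 J1"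
  shows "\<exists>x \<in> tail c \<Delta> \<inter> face n J0 J1. \<forall>i. i \<notin> N c \<longrightarrow> x i = y i"
proof (cases "N c \<subseteq> J0 \<union> J1")
  case True
  then have "y \<in> tail c \<Delta> \<inter> face n J0 J1"
    using tail_step_fixed[OF assms(1,2) _ assms(4)] assms(3,5) by (simp add: individually_complete_def)
  then show ?thesis by blast
next
  case False
  then show ?thesis
    using tail_extend[OF assms(1-4)] assms(5) by (simp add: next_group_def)
qed

lemma tail_step_empty_iff:
  assumes "inverse_closed \<Delta>" "c \<in> {1..m}" "individually_complete c \<Delta> J0 J1" "J0 \<inter> J1 = {}"
  shows "tail (Suc c) (next_group (N c) \<Delta> J0 J1) \<inter> face n J0 J1 = {} \<longleftrightarrow>
    tail c \<Delta> \<inter> face n J0 J1 = {}"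
  using tail_step_subset[OF assms] tail_step_extend[OF assms] by blast

text \<open>Solutions remain solutions after the step, and a solution after the step is repaired
  inside the block only. So fixings found by later iterations, which see only the smaller group, are
  exact for the current problem.\<close>

lemma tail_step_values:
  assumes "inverse_closed \<Delta>" "c \<in> {1..m}" "individually_complete c \<Delta> J0 J1" "J0 \<inter> J1 = {}" "i \<notin> N c"
  shows "(\<forall>x \<in> tail (Suc c) (next_group (N c) \<Delta> J0 J1) \<inter> face n J0 J1. x i = b) \<longleftrightarrow>
    (\<forall>x \<in> tail c \<Delta> \<inter> face n J0 J1. x i = b)"
  using tail_step_subset[OF assms(1-4)] tail_step_extend[OF assms(1-4)] assms(5)
  by (metis (no_types, lifting) subsetD)

section \<open>The loop without fixings as an emptiness test\<close>

text \<open>Induction from the end of the loop, where disjoint fixings define a nonempty face. Every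
  earlier iteration preserves emptiness in both directions, so all runs agree.\<close>

lemma loop_without_fixings_result:
  assumes "c \<in> {1..Suc m}" "inverse_closed \<Delta>" "J0 \<inter> J1 = {}" "J0 \<subseteq> {1..n}" "J1 \<subseteq> {1..n}"
    and "propagate_loop n m N c False \<Delta> J0 J1 r"
  shows "r = (if tail c \<Delta> \<inter> face n J0 J1 = {} then Infeasible else Feasible None)"
  using assms
proof (induction "Suc m - c" arbitrary: c \<Delta> J0 J1 r)
  case 0
  then have c: "c = Suc m" by simp
  from 0(7) have "r = Feasible None"
    unfolding c by cases auto
  moreover have "tail c \<Delta> \<inter> face n J0 J1 \<noteq> {}"
    using face_nonempty[OF 0(4-6)] unfolding c tail_Suc_m by (auto simp: face_def)
  ultimately show ?case by simp
next
  case (Suc k)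
  then have c: "c \<in> {1..m}" and k: "k = Suc m - Suc c" and Sc: "Suc c \<in> {1..Suc m}" by auto
  note indiv = propagate_individually_None[OF Suc(4) c Suc(5-7)]
    propagate_individually_Some[OF Suc(4) c Suc(5-7)]
  from Suc(8) show ?case
  proof cases
    case (loop_infeasible_joint K0 K1)
    then show ?thesis
      using joint_infeasible[OF Suc(4) c loop_infeasible_joint(4)]
        indiv(2)[OF loop_infeasible_joint(3)] by simp
  next
    case (loop_without_fixings K0 K1)
    note K = indiv(2-)[OF loop_without_fixings(2)]
    show ?thesis
      using Suc(1)[OF k Sc inverse_closed_next_group[OF Suc(4) c] K(6-8) loop_without_fixings(4)]
        tail_step_empty_iff[OF Suc(4) c K(9,6)] K(1) by simp
  qed (use c indiv in auto)
qed

lemma loop_without_fixings_exists: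
  assumes "c \<in> {1..Suc m}" "inverse_closed \<Delta>" "J0 \<inter> J1 = {}" "J0 \<subseteq> {1..n}" "J1 \<subseteq> {1..n}"
  shows "\<exists>r. propagate_loop n m N c False \<Delta> J0 J1 r"
  using assms
proof (induction "Suc m - c" arbitrary: c \<Delta> J0 J1)
  case 0
  then show ?case using loop_end[of m c n N False] by (intro exI) auto
next
  case (Suc k)
  then have c: "c \<in> {1..m}" "c \<le> m" and k: "k = Suc m - Suc c" and Sc: "Suc c \<in> {1..Suc m}" by auto
  obtain q where q: "propagate_individually n (restr_set \<Delta> (N c)) J0 J1 q"
    using propagate_individually_exists by blast
  show ?case
  proof (cases q)
    case None
    then show ?thesis using loop_infeasible_individual[OF c(2)] q by blast
  next
    case (Some K)
    then obtain K0 K1 where K: "propagate_individually n (restr_set \<Delta> (N c)) J0 J1 (Some (K0, K1))"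
      using q by (cases K) auto
    note K' = propagate_individually_Some[OF Suc(4) c(1) Suc(5-7) K]
    show ?thesis
      using Suc(1)[OF k Sc inverse_closed_next_group[OF Suc(4) c(1)] K'(6-8)]
        loop_infeasible_joint[where N = N and c = c and \<Delta> = \<Delta>, OF c(2) K]
        loop_without_fixings[where N = N and c = c and \<Delta> = \<Delta>, OF c(2) K]
      by metis
  qed
qed

lemma propagate_without_fixings_iff:
  assumes "c \<in> {1..Suc m}" "inverse_closed \<Delta>" "J0 \<inter> J1 = {}" "J0 \<subseteq> {1..n}" "J1 \<subseteq> {1..n}"
  shows "propagate n m N \<Delta> J0 J1 c False r \<longleftrightarrow>
    r = (if tail c \<Delta> \<inter> face n J0 J1 = {} then Infeasible else Feasible None)"
  using loop_without_fixings_result[OF assms] loop_without_fixings_exists[OF assms]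
  by (metis propagate.cases start)

section \<open>Probing the free entries of a block\<close>

text \<open>By exactness of the inner calls, a probe fails if and only if no solution has the probed
  value. A fixing found in this way leaves the solution set unchanged, so later probes refer to the
  same set and the order of visits does not matter. Without any solution every first probe fails,
  hence the proviso for the exact description.\<close>

lemma probe_invariants:
  assumes "c \<in> {1..m}" "inverse_closed \<Delta>" "finite S" "S \<subseteq> {1..n}" "S \<inter> (K0 \<union> K1) = {}"
    and "K0 \<inter> K1 = {}" "K0 \<subseteq> {1..n}" "K1 \<subseteq> {1..n}"
    and "probe_fixings n m N c \<Delta> S K0 K1 L0 L1"
  defines "X \<equiv> tail c \<Delta>"
  shows "K0 \<subseteq> L0 \<and> K1 \<subseteq> L1 \<and> L0 \<subseteq> K0 \<union> S \<and> L1 \<subseteq> K1 \<union> S \<and> L0 \<inter> L1 = {} \<and>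
    (X \<inter> face n K0 K1 \<noteq> {} \<longrightarrow> X \<inter> face n L0 L1 = X \<inter> face n K0 K1 \<and>
      L0 = K0 \<union> {i \<in> S. \<forall>x \<in> X \<inter> face n K0 K1. x i = 0} \<and>
      L1 = K1 \<union> {i \<in> S. \<forall>x \<in> X \<inter> face n K0 K1. x i = 1})"
  using assms(3-9)
proof (induction "card S" arbitrary: S K0 K1 rule: less_induct)
  case less
  let ?Y = "X \<inter> face n K0 K1"
  have call0: "propagate n m N \<Delta> (K0 \<union> {i}) K1 c False r \<longleftrightarrow>
      r = (if X \<inter> face n (K0 \<union> {i}) K1 = {} then Infeasible else Feasible None)"
    and call1: "propagate n m N \<Delta> K0 (K1 \<union> {i}) c False r \<longleftrightarrow>
      r = (if X \<inter> face n K0 (K1 \<union> {i}) = {} then Infeasible else Feasible None)"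
    if "i \<in> S" for i r
  proof -
    have "i \<notin> K0" "i \<notin> K1" "i \<in> {1..n}" "c \<in> {1..Suc m}"
      using that less.prems assms(1) by auto
    then show "propagate n m N \<Delta> (K0 \<union> {i}) K1 c False r \<longleftrightarrow>
      r = (if X \<inter> face n (K0 \<union> {i}) K1 = {} then Infeasible else Feasible None)"
      "propagate n m N \<Delta> K0 (K1 \<union> {i}) c False r \<longleftrightarrow>
      r = (if X \<inter> face n K0 (K1 \<union> {i}) = {} then Infeasible else Feasible None)"
      unfolding X_def using assms(2) less.prems(4-6)
      by (intro propagate_without_fixings_iff; auto)+
  qed
  have face0: "X \<inter> face n (K0 \<union> {i}) K1 = {x \<in> ?Y. x i = 0}"
    and face1: "X \<inter> face n K0 (K1 \<union> {i}) = {x \<in> ?Y. x i = 1}" for i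
    by (auto simp: face_def)
  have val: "x i = 0 \<or> x i = 1" if "x \<in> ?Y" "i \<in> S" for x i
    using that less.prems(2) cube_values[of x n i] by (auto simp: face_def)
  have card: "card (S - {i}) < card S" if "i \<in> S" for i
    using that less.prems(1) by (meson card_Diff1_less)
  have fin: "finite (S - {i})" "S - {i} \<subseteq> {1..n}" for i
    using less.prems by auto
  from less.prems(7) show ?case
  proof cases
    case probe_end
    then show ?thesis using less.prems by auto
  next
    case (probe_one i)
    then have e: "{x \<in> ?Y. x i = 0} = {}"
      using call0 face0 by (auto split: if_splits)
    then have "{x \<in> ?Y. x i = 1} = ?Y"
      using val \<open>i \<in> S\<close> by blast
    with face1 have eq: "X \<inter> face n K0 (K1 \<union> {i}) = ?Y" by simp
    have "(S - {i}) \<inter> (K0 \<union> (K1 \<union> {i})) = {}" "K0 \<inter> (K1 \<union> {i}) = {}" "K1 \<union> {i} \<subseteq> {1..n}"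
      using less.prems \<open>i \<in> S\<close> by auto
    from less.hyps[OF card[OF \<open>i \<in> S\<close>] fin(1,2) this(1,2) less.prems(5) this(3) probe_one(3)]
    have IH: "K0 \<subseteq> L0 \<and> K1 \<union> {i} \<subseteq> L1 \<and> L0 \<subseteq> K0 \<union> (S - {i}) \<and> L1 \<subseteq> K1 \<union> {i} \<union> (S - {i}) \<and>
      L0 \<inter> L1 = {} \<and>
      (?Y \<noteq> {} \<longrightarrow> X \<inter> face n L0 L1 = ?Y \<and>
        L0 = K0 \<union> {j \<in> S - {i}. \<forall>x \<in> ?Y. x j = 0} \<and>
        L1 = K1 \<union> {i} \<union> {j \<in> S - {i}. \<forall>x \<in> ?Y. x j = 1})"
      unfolding eq .
    have "\<forall>x \<in> ?Y. x i = 1"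
      using \<open>{x \<in> ?Y. x i = 1} = ?Y\<close> by blast
    then have "{j \<in> S. \<forall>x \<in> ?Y. x j = 1} = {i} \<union> {j \<in> S - {i}. \<forall>x \<in> ?Y. x j = 1}"
      using \<open>i \<in> S\<close> by blast
    moreover have "?Y \<noteq> {} \<Longrightarrow> {j \<in> S. \<forall>x \<in> ?Y. x j = 0} = {j \<in> S - {i}. \<forall>x \<in> ?Y. x j = 0}"
      using \<open>i \<in> S\<close> e by blast
    ultimately show ?thesis
      using IH \<open>i \<in> S\<close> by (simp add: Un_assoc) blast
  next
    case (probe_zero i s)
    then have e: "{x \<in> ?Y. x i = 1} = {}"
      using call1 face1 by (auto split: if_splits)
    then have "{x \<in> ?Y. x i = 0} = ?Y"
      using val \<open>i \<in> S\<close> by blast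
    with face0 have eq: "X \<inter> face n (K0 \<union> {i}) K1 = ?Y" by simp
    have "(S - {i}) \<inter> ((K0 \<union> {i}) \<union> K1) = {}" "(K0 \<union> {i}) \<inter> K1 = {}" "K0 \<union> {i} \<subseteq> {1..n}"
      using less.prems \<open>i \<in> S\<close> by auto
    from less.hyps[OF card[OF \<open>i \<in> S\<close>] fin(1,2) this less.prems(6) probe_zero(4)]
    have IH: "K0 \<union> {i} \<subseteq> L0 \<and> K1 \<subseteq> L1 \<and> L0 \<subseteq> K0 \<union> {i} \<union> (S - {i}) \<and> L1 \<subseteq> K1 \<union> (S - {i}) \<and>
      L0 \<inter> L1 = {} \<and>
      (?Y \<noteq> {} \<longrightarrow> X \<inter> face n L0 L1 = ?Y \<and>
        L0 = K0 \<union> {i} \<union> {j \<in> S - {i}. \<forall>x \<in> ?Y. x j = 0} \<and>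
        L1 = K1 \<union> {j \<in> S - {i}. \<forall>x \<in> ?Y. x j = 1})"
      unfolding eq .
    have "\<forall>x \<in> ?Y. x i = 0"
      using \<open>{x \<in> ?Y. x i = 0} = ?Y\<close> by blast
    then have "{j \<in> S. \<forall>x \<in> ?Y. x j = 0} = {i} \<union> {j \<in> S - {i}. \<forall>x \<in> ?Y. x j = 0}"
      using \<open>i \<in> S\<close> by blast
    moreover have "?Y \<noteq> {} \<Longrightarrow> {j \<in> S. \<forall>x \<in> ?Y. x j = 1} = {j \<in> S - {i}. \<forall>x \<in> ?Y. x j = 1}"
      using \<open>i \<in> S\<close> e by blast
    ultimately show ?thesis
      using IH \<open>i \<in> S\<close> by (simp add: Un_assoc) blast
  next
    case (probe_none i s s')
    then have ex: "\<exists>x \<in> ?Y. x i = 0" "\<exists>x \<in> ?Y. x i = 1"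
      using call0 call1 face0 face1 by (auto split: if_splits)
    have "(S - {i}) \<inter> (K0 \<union> K1) = {}"
      using less.prems by auto
    from less.hyps[OF card[OF \<open>i \<in> S\<close>] fin(1,2) this less.prems(4-6) probe_none(4)]
    have IH: "K0 \<subseteq> L0 \<and> K1 \<subseteq> L1 \<and> L0 \<subseteq> K0 \<union> (S - {i}) \<and> L1 \<subseteq> K1 \<union> (S - {i}) \<and> L0 \<inter> L1 = {} \<and>
      (?Y \<noteq> {} \<longrightarrow> X \<inter> face n L0 L1 = ?Y \<and>
        L0 = K0 \<union> {j \<in> S - {i}. \<forall>x \<in> ?Y. x j = 0} \<and>
        L1 = K1 \<union> {j \<in> S - {i}. \<forall>x \<in> ?Y. x j = 1})"
      .
    have "{j \<in> S. \<forall>x \<in> ?Y. x j = b} = {j \<in> S - {i}. \<forall>x \<in> ?Y. x j = b}" for b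
    proof -
      have "\<not> (\<forall>x \<in> ?Y. x i = b)"
        using ex by (metis zero_neq_one)
      then show ?thesis by blast
    qed
    then show ?thesis
      using IH by (simp) blast
  qed
qed

lemma probe_exists:
  assumes "c \<in> {1..m}" "inverse_closed \<Delta>" "finite S" "S \<subseteq> {1..n}" "S \<inter> (K0 \<union> K1) = {}"
    and "K0 \<inter> K1 = {}" "K0 \<subseteq> {1..n}" "K1 \<subseteq> {1..n}"
  shows "\<exists>L0 L1. probe_fixings n m N c \<Delta> S K0 K1 L0 L1"
  using assms(3-8)
proof (induction S arbitrary: K0 K1 rule: finite_induct)
  case empty
  then show ?case using probe_end by blast
next
  case (insert i S)
  have S: "insert i S - {i} = S" using insert by simp
  have c: "c \<in> {1..Suc m}" using assms(1) by simp
  have i: "(K0 \<union> {i}) \<inter> K1 = {}" "K0 \<union> {i} \<subseteq> {1..n}" "K0 \<inter> (K1 \<union> {i}) = {}" "K1 \<union> {i} \<subseteq> {1..n}"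
    using insert.prems by auto
  obtain L where L: "probe_fixings n m N c \<Delta> S K0 K1 (fst L) (snd L)"
    using insert.IH[of K0 K1] insert.prems by auto
  obtain L' where L': "probe_fixings n m N c \<Delta> S (K0 \<union> {i}) K1 (fst L') (snd L')"
    using insert.IH[of "K0 \<union> {i}" K1] insert.prems insert.hyps by auto
  obtain L'' where L'': "probe_fixings n m N c \<Delta> S K0 (K1 \<union> {i}) (fst L'') (snd L'')"
    using insert.IH[of K0 "K1 \<union> {i}"] insert.prems insert.hyps by auto
  obtain r0 where r0: "propagate n m N \<Delta> (K0 \<union> {i}) K1 c False r0"
    using propagate_without_fixings_iff[OF c assms(2) i(1,2) insert.prems(5)] by blast
  obtain r1 where r1: "propagate n m N \<Delta> K0 (K1 \<union> {i}) c False r1"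
    using propagate_without_fixings_iff[OF c assms(2) i(3) insert.prems(4) i(4)] by blast
  show ?case
  proof (cases r0)
    case Infeasible
    then show ?thesis using probe_one[of i "insert i S"] r0 L'' unfolding S by blast
  next
    case (Feasible s)
    note r0' = r0[unfolded Feasible]
    show ?thesis
    proof (cases r1)
      case Infeasible
      then show ?thesis
        using probe_zero[OF insertI1 r0' r1[unfolded Infeasible], of S] L' unfolding S by blast
    next
      case (Feasible s')
      then show ?thesis
        using probe_none[OF insertI1 r0' r1[unfolded Feasible], of S] L unfolding S by blast
    qed
  qed
qed

text \<open>A quantity that stays constant along a feasible run: it keeps \<open>J\<close> outside
  the positions from \<open>a c\<close> on and takes the ideal answer there. For
  \<open>c = 1\<close> and \<open>J\<close> inside \<open>{1..n}\<close> it is the complete set of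
  fixings, for \<open>c = Suc m\<close> it is \<open>J\<close> itself.\<close>

definition fixings :: "nat \<Rightarrow> (nat \<Rightarrow> nat) set \<Rightarrow> nat set \<Rightarrow> nat set \<Rightarrow> nat set \<Rightarrow> real \<Rightarrow> nat set" where
  "fixings c \<Delta> J0 J1 J b =
     (J - {a c..n}) \<union> {i \<in> {a c..n}. \<forall>x \<in> tail c \<Delta> \<inter> face n J0 J1. x i = b}"

text \<open>If there is a solution, probing does not change the solution set, so the step to the
  next block can be taken with the enlarged fixings once these are known to be individually
  complete.\<close>

lemma probe_step:
  assumes c: "c \<in> {1..m}" and \<Delta>: "inverse_closed \<Delta>"
    and K: "individually_complete c \<Delta> K0 K1" "K0 \<inter> K1 = {}" "K0 \<subseteq> {1..n}" "K1 \<subseteq> {1..n}"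
    and probe: "probe_fixings n m N c \<Delta> (N c - (K0 \<union> K1)) K0 K1 L0 L1"
  shows "L0 \<inter> L1 = {}" "L0 \<subseteq> {1..n}" "L1 \<subseteq> {1..n}"
    "tail (Suc c) (next_group (N c) \<Delta> L0 L1) \<inter> face n L0 L1 = {} \<longleftrightarrow> tail c \<Delta> \<inter> face n K0 K1 = {}"
    "tail c \<Delta> \<inter> face n K0 K1 \<noteq> {} \<Longrightarrow>
      fixings (Suc c) (next_group (N c) \<Delta> L0 L1) L0 L1 L0 0 = fixings c \<Delta> K0 K1 K0 0"
    "tail c \<Delta> \<inter> face n K0 K1 \<noteq> {} \<Longrightarrow>
      fixings (Suc c) (next_group (N c) \<Delta> L0 L1) L0 L1 L1 1 = fixings c \<Delta> K0 K1 K1 1"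
proof -
  let ?S = "N c - (K0 \<union> K1)" and ?Y = "tail c \<Delta> \<inter> face n K0 K1"
  let ?Z = "tail (Suc c) (next_group (N c) \<Delta> L0 L1) \<inter> face n L0 L1"
  have S: "finite ?S" "?S \<subseteq> {1..n}" "?S \<inter> (K0 \<union> K1) = {}"
    using finite_N[OF c] N_subset[OF c] by auto
  note L = probe_invariants[OF c \<Delta> S K(2-4) probe]
  show dis: "L0 \<inter> L1 = {}" and "L0 \<subseteq> {1..n}" "L1 \<subseteq> {1..n}"
    using L K N_subset[OF c] by auto
  \<comment> \<open>If there is no solution, then every probe fails and the whole block ends up fixed, possibly to
    values violating the constraints of that block. Infeasibility is not lost, because the next group
    still contains the pointwise stabilizer.\<close>
  have empty: "?Z = {}" if Y: "?Y = {}"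
  proof (cases "?S = {}")
    case True
    then have "L0 = K0" "L1 = K1" using L by auto
    then show ?thesis
      using tail_step_empty_iff[OF \<Delta> c K(1,2)] Y by simp
  next
    case False
    then have free: "\<not> N c \<subseteq> K0 \<union> K1" by auto
    have "?Z \<subseteq> tail (Suc c) (pointwise_stab (N c) \<Delta>) \<inter> face n K0 K1"
      using L tail_mono[OF pointwise_stab_subset_next_group] face_mono[of K0 L0 K1 L1 n] by blast
    then show ?thesis
      using tail_extend[OF \<Delta> c K(1,2) free] Y by blast
  qed
  {
    assume Y: "?Y \<noteq> {}"
    have eq: "tail c \<Delta> \<inter> face n L0 L1 = ?Y"
      and L0: "L0 = K0 \<union> {i \<in> ?S. \<forall>x \<in> ?Y. x i = 0}"
      and L1: "L1 = K1 \<union> {i \<in> ?S. \<forall>x \<in> ?Y. x i = 1}"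
      using L Y by blast+
    have K_sub: "K0 \<subseteq> L0" "K1 \<subseteq> L1"
      using L by simp_all
    \<comment> \<open>A fixing valid for a single constraint would be forced on \<open>?Y\<close>,
      and probing has already recorded all forced entries of the block.\<close>
    have compl: "individually_complete c \<Delta> L0 L1"
      unfolding individually_complete_def
    proof (intro conjI ballI notI)
      assume "detects_infeasible n (restr_set \<Delta> (N c)) L0 L1"
      then show False
        using tail_subset_symre[OF \<Delta> c] eq Y unfolding detects_infeasible_def by blast
    next
      fix i \<pi> b assume i: "i \<in> N c - (L0 \<union> L1)" and \<pi>: "\<pi> \<in> restr_set \<Delta> (N c)"
        and b: "b \<in> {0, 1::real}" and valid: "valid_fixing n \<pi> L0 L1 i b"
      have "\<forall>x \<in> ?Y. x i = b"
        using valid tail_subset_symre[OF \<Delta> c \<pi>] unfolding eq[symmetric] valid_fixing_def by blast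
      moreover have "i \<in> ?S"
        using i K_sub by blast
      ultimately show False
        using b i L0 L1 by auto
    qed
    have vals: "(\<forall>x \<in> ?Z. x i = b) \<longleftrightarrow> (\<forall>x \<in> ?Y. x i = b)" if "i \<in> {a (Suc c)..n}" for i b
      using tail_step_values[OF \<Delta> c compl dis, of i b] that N_before_tail[OF c, of i i]
      unfolding eq by blast
    have nonempty: "?Z \<noteq> {}"
      using tail_step_empty_iff[OF \<Delta> c compl dis] Y eq by simp
    have block: "i \<in> L \<longleftrightarrow> (\<forall>x \<in> ?Y. x i = b)"
      if i: "i \<in> N c" and Lb: "L = L0 \<and> b = 0 \<or> L = L1 \<and> b = 1" for i b L
    proof -
      \<comment> \<open>A member of \<open>?Y\<close> is what leads from forced values to membership
        in \<open>L\<close>: over an empty set both values would be forced.\<close>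
      obtain x where x: "x \<in> ?Y" using Y by blast
      have K01: "\<forall>x \<in> ?Y. (i \<in> K0 \<longrightarrow> x i = 0) \<and> (i \<in> K1 \<longrightarrow> x i = 1)"
        by (auto simp: face_def)
      consider "i \<in> K0" "i \<notin> K1" | "i \<in> K1" "i \<notin> K0" | "i \<in> ?S" "i \<notin> K0" "i \<notin> K1"
        using i K(2) by blast
      then show ?thesis
      proof cases
        case 1
        then have "\<forall>x \<in> ?Y. x i = 0" using K01 by blast
        moreover from this have "x i = 0" using x by blast
        ultimately show ?thesis using 1 Lb bspec[OF _ x, of "\<lambda>x. x i = b"] L0 L1 by auto
      next
        case 2
        then have "\<forall>x \<in> ?Y. x i = 1" using K01 by blast
        moreover from this have "x i = 1" using x by blast
        ultimately show ?thesis using 2 Lb bspec[OF _ x, of "\<lambda>x. x i = b"] L0 L1 by auto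
      next
        case 3
        then show ?thesis using Lb L0 L1 by auto
      qed
    qed
    have "fixings (Suc c) (next_group (N c) \<Delta> L0 L1) L0 L1 L b = fixings c \<Delta> K0 K1 K b"
      if "L = L0 \<and> K = K0 \<and> b = 0 \<or> L = L1 \<and> K = K1 \<and> b = 1" for L K b
    proof (rule Set.set_eqI)
      fix i
      have KL: "K \<subseteq> L" "L \<subseteq> K \<union> N c"
        using that L by auto
      have disj: "i \<in> N c \<Longrightarrow> i \<notin> {a (Suc c)..n}"
        using N_before_tail[OF c, of i i] by blast
      show "i \<in> fixings (Suc c) (next_group (N c) \<Delta> L0 L1) L0 L1 L b \<longleftrightarrow> i \<in> fixings c \<Delta> K0 K1 K b"
      proof (cases "i \<in> N c")
        case True
        then show ?thesis
          using block[OF True, of L b] that disj tail_split[OF c] unfolding fixings_def by blast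
      next
        case False
        then show ?thesis
          using vals[of i b] KL tail_split[OF c] unfolding fixings_def by blast
      qed
    qed
    note nonempty this
  }
  then show "?Z = {} \<longleftrightarrow> ?Y = {}"
    "?Y \<noteq> {} \<Longrightarrow> fixings (Suc c) (next_group (N c) \<Delta> L0 L1) L0 L1 L0 0 = fixings c \<Delta> K0 K1 K0 0"
    "?Y \<noteq> {} \<Longrightarrow> fixings (Suc c) (next_group (N c) \<Delta> L0 L1) L0 L1 L1 1 = fixings c \<Delta> K0 K1 K1 1"
    using empty by blast+
qed

section \<open>The loop with fixings\<close>

lemma loop_with_fixings_result:
  assumes "c \<in> {1..Suc m}" "inverse_closed \<Delta>" "J0 \<inter> J1 = {}" "J0 \<subseteq> {1..n}" "J1 \<subseteq> {1..n}"
    and "propagate_loop n m N c True \<Delta> J0 J1 r"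
  shows "r = (if tail c \<Delta> \<inter> face n J0 J1 = {} then Infeasible
    else Feasible (Some (fixings c \<Delta> J0 J1 J0 0, fixings c \<Delta> J0 J1 J1 1)))"
  using assms
proof (induction "Suc m - c" arbitrary: c \<Delta> J0 J1 r)
  case 0
  then have c: "c = Suc m" by simp
  from 0(7) have "r = Feasible (Some (J0, J1))"
    unfolding c by cases auto
  moreover have "tail c \<Delta> \<inter> face n J0 J1 \<noteq> {}"
    using face_nonempty[OF 0(4-6)] unfolding c tail_Suc_m by (auto simp: face_def)
  moreover have "fixings c \<Delta> J0 J1 J b = J" for J b
    unfolding c fixings_def a_Suc_m by simp
  ultimately show ?case by simp
next
  case (Suc k)
  then have c: "c \<in> {1..m}" and k: "k = Suc m - Suc c" and Sc: "Suc c \<in> {1..Suc m}" by auto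
  note indiv = propagate_individually_None[OF Suc(4) c Suc(5-7)]
    propagate_individually_Some[OF Suc(4) c Suc(5-7)]
  from Suc(8) show ?case
  proof cases
    case (loop_infeasible_joint K0 K1)
    then show ?thesis
      using joint_infeasible[OF Suc(4) c loop_infeasible_joint(4)]
        indiv(2)[OF loop_infeasible_joint(3)] by simp
  next
    case (loop_with_fixings K0 K1 L0 L1)
    note K = indiv(2-)[OF loop_with_fixings(2)]
    note L = probe_step[OF c Suc(4) K(9) K(6-8) loop_with_fixings(4)]
    \<comment> \<open>Individual propagation preserves the solutions and adds indices of the block
      only, so neither part of \<open>fixings\<close> changes.\<close>
    have "fixings c \<Delta> K0 K1 K0 b = fixings c \<Delta> J0 J1 J0 b"
      "fixings c \<Delta> K0 K1 K1 b = fixings c \<Delta> J0 J1 J1 b" for b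
      using K(1-5) tail_split[OF c] unfolding fixings_def by blast+
    then show ?thesis
      using Suc(1)[OF k Sc inverse_closed_next_group[OF Suc(4) c] L(1-3) loop_with_fixings(5)] L(4-6) K(1)
      by simp
  qed (use c indiv in auto)
qed

lemma loop_with_fixings_exists:
  assumes "c \<in> {1..Suc m}" "inverse_closed \<Delta>" "J0 \<inter> J1 = {}" "J0 \<subseteq> {1..n}" "J1 \<subseteq> {1..n}"
  shows "\<exists>r. propagate_loop n m N c True \<Delta> J0 J1 r"
  using assms
proof (induction "Suc m - c" arbitrary: c \<Delta> J0 J1)
  case 0
  then show ?case using loop_end[of m c n N True] by (intro exI) auto
next
  case (Suc k)
  then have c: "c \<in> {1..m}" "c \<le> m" and k: "k = Suc m - Suc c" and Sc: "Suc c \<in> {1..Suc m}" by auto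
  obtain q where q: "propagate_individually n (restr_set \<Delta> (N c)) J0 J1 q"
    using propagate_individually_exists by blast
  show ?case
  proof (cases q)
    case None
    then show ?thesis using loop_infeasible_individual[OF c(2)] q by blast
  next
    case (Some K)
    then obtain K0 K1 where K: "propagate_individually n (restr_set \<Delta> (N c)) J0 J1 (Some (K0, K1))"
      using q by (cases K) auto
    note K' = propagate_individually_Some[OF Suc(4) c(1) Suc(5-7) K]
    have S: "finite (N c - (K0 \<union> K1))" "N c - (K0 \<union> K1) \<subseteq> {1..n}" "(N c - (K0 \<union> K1)) \<inter> (K0 \<union> K1) = {}"
      using finite_N[OF c(1)] N_subset[OF c(1)] by auto
    obtain L0 L1 where L: "probe_fixings n m N c \<Delta> (N c - (K0 \<union> K1)) K0 K1 L0 L1"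
      using probe_exists[OF c(1) Suc(4) S K'(6-8)] by blast
    note L' = probe_step[OF c(1) Suc(4) K'(9) K'(6-8) L]
    show ?thesis
      using Suc(1)[OF k Sc inverse_closed_next_group[OF Suc(4) c(1)] L'(1-3)]
        loop_infeasible_joint[where N = N and c = c and \<Delta> = \<Delta>, OF c(2) K]
        loop_with_fixings[where N = N and c = c and \<Delta> = \<Delta>, OF c(2) K _ L] by metis
  qed
qed

lemma symretope_inter_face: "symretope n \<Delta> \<inter> face n J0 J1 = tail 1 \<Delta> \<inter> face n J0 J1"
  unfolding symretope_def symre_def tail_def face_def lex_geq_iff_lex_on a_1 by auto

lemma propagate_correct:
  assumes "inverse_closed \<Delta>" "I0 \<inter> I1 = {}" "I0 \<subseteq> {1..n}" "I1 \<subseteq> {1..n}"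
  shows "propagate n m N \<Delta> I0 I1 1 True r \<longleftrightarrow>
    r = (if symretope n \<Delta> \<inter> face n I0 I1 = {} then Infeasible
      else Feasible (Some ({i \<in> {1..n}. \<forall>x \<in> symretope n \<Delta> \<inter> face n I0 I1. x i = 0},
        {i \<in> {1..n}. \<forall>x \<in> symretope n \<Delta> \<inter> face n I0 I1. x i = 1})))"
proof -
  have 1: "1 \<in> {1..Suc m}" by simp
  have "fixings 1 \<Delta> I0 I1 I b = {i \<in> {1..n}. \<forall>x \<in> symretope n \<Delta> \<inter> face n I0 I1. x i = b}"
    if "I \<subseteq> {1..n}" for I b
    using that unfolding fixings_def a_1 symretope_inter_face by auto
  note fixings = this[OF assms(3)] this[OF assms(4)]
  have iff: "propagate n m N \<Delta> I0 I1 1 True s \<longleftrightarrow> propagate_loop n m N 1 True \<Delta> I0 I1 s" for s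
    by (auto elim: propagate.cases intro: start)
  note result = loop_with_fixings_result[OF 1 assms, unfolded fixings symretope_inter_face[symmetric]]
  obtain s where s: "propagate_loop n m N 1 True \<Delta> I0 I1 s"
    using loop_with_fixings_exists[OF 1 assms] by blast
  show ?thesis
    unfolding iff
  proof
    assume "r = (if symretope n \<Delta> \<inter> face n I0 I1 = {} then Infeasible
      else Feasible (Some ({i \<in> {1..n}. \<forall>x \<in> symretope n \<Delta> \<inter> face n I0 I1. x i = 0},
        {i \<in> {1..n}. \<forall>x \<in> symretope n \<Delta> \<inter> face n I0 I1. x i = 1})))"
    then show "propagate_loop n m N 1 True \<Delta> I0 I1 r"
      using result[OF s] s by simp
  qed (rule result)
qed

end

subsection \<open>Monotone and ordered permutations\<close>

lemma supp_image: "bij f \<Longrightarrow> f k \<in> supp f \<longleftrightarrow> k \<in> supp f"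
  unfolding supp_def using bij_is_inj[THEN inj_eq, of f "f k" k] by simp

text \<open>Only one position descends. The preimage of \<open>a\<close> and the position
  \<open>b - 1\<close> both do, so they coincide. Any other position ascends, so the preimage of
  \<open>k + 1\<close> is at most \<open>k\<close>; smaller ones are already mapped to their own
  successors.\<close>

lemma monotone_cycle_successor:
  assumes bij: "bij \<zeta>" and mono: "monotone_cycle \<zeta>" and supp: "supp \<zeta> = {a..<b}" and "r < b - a"
  shows "\<zeta> (a + r) = a + (r + 1) mod (b - a)"
proof -
  have unique: "j = k" if "\<zeta> j < j" "\<zeta> k < k" for j k
    using mono that unfolding monotone_cycle_def by blast
  have ab: "a < b" using assms(4) by simp
  have moved: "\<zeta> k \<noteq> k" "\<zeta> k \<in> {a..<b}" if "k \<in> {a..<b}" for k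
  proof -
    have k: "k \<in> supp \<zeta>" using that supp by simp
    then show "\<zeta> k \<noteq> k" by (simp add: supp_def)
    show "\<zeta> k \<in> {a..<b}" using k supp_image[OF bij, of k] supp by simp
  qed
  have preimage: "\<exists>j\<in>{a..<b}. \<zeta> j = k" if "k \<in> {a..<b}" for k
  proof -
    obtain j where "\<zeta> j = k" using bij_is_surj[OF bij] by (metis surjD)
    then show ?thesis using that supp_image[OF bij, of j] supp by auto
  qed
  obtain j where j: "j \<in> {a..<b}" "\<zeta> j = a"
    using preimage[of a] ab by auto
  then have "\<zeta> j < j"
    using moved(1)[of j] by auto
  moreover have "\<zeta> (b - 1) < b - 1"
  proof -
    have "b - 1 \<in> {a..<b}" using ab by auto
    from moved[OF this] show ?thesis by auto
  qed
  ultimately have "j = b - 1"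
    by (rule unique)
  then have last: "\<zeta> (b - 1) = a"
    using j by simp
  have step: "a \<le> k \<Longrightarrow> k < b - 1 \<Longrightarrow> \<zeta> k = k + 1" for k
  proof (induction k rule: less_induct)
    case (less k)
    have "k + 1 \<in> {a..<b}"
      using less.prems by auto
    from preimage[OF this] obtain j where j: "j \<in> {a..<b}" "\<zeta> j = k + 1"
      by blast
    have "j \<noteq> b - 1"
      using j last less.prems by auto
    then have "\<not> \<zeta> j < j"
      using unique[OF _ \<open>\<zeta> (b - 1) < b - 1\<close>] by blast
    then have "j \<le> k"
      using moved(1)[OF j(1)] j(2) by simp
    then show ?case
      using less.IH[of j] less.prems j by (cases "j = k") auto
  qed
  show ?thesis
  proof (cases "r = b - a - 1")
    case True
    then have "r + 1 = b - a" "a + r = b - 1"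
      using ab by auto
    then show ?thesis using last by simp
  next
    case False
    then show ?thesis using step[of "a + r"] assms(4) by simp
  qed
qed

text \<open>A bijection maps its support to itself. Hence once a factor has moved \<open>k\<close>,
  the image stays in the support of that factor and the factors applied afterwards leave it
  alone.\<close>

lemma foldr_disjoint_perms:
  assumes "distinct xs" "disjoint_family_on (\<lambda>c. supp (\<zeta> c)) (set xs)" "\<And>c. c \<in> set xs \<Longrightarrow> bij (\<zeta> c)"
  shows "(\<forall>c\<in>set xs. \<forall>k\<in>supp (\<zeta> c). foldr (\<circ>) (map \<zeta> xs) id k = \<zeta> c k) \<and>
    (\<forall>k. k \<notin> (\<Union>c\<in>set xs. supp (\<zeta> c)) \<longrightarrow> foldr (\<circ>) (map \<zeta> xs) id k = k)"
  using assms
proof (induction xs)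
  case (Cons d xs)
  have "distinct xs" "disjoint_family_on (\<lambda>c. supp (\<zeta> c)) (set xs)" "\<And>c. c \<in> set xs \<Longrightarrow> bij (\<zeta> c)"
    using Cons.prems by (auto intro: disjoint_family_on_mono)
  note IH = Cons.IH[OF this]
  have dis: "k \<notin> supp (\<zeta> d)" if "c \<in> set xs" "k \<in> supp (\<zeta> c)" for c k
    using Cons.prems(1,2) that unfolding disjoint_family_on_def by fastforce
  have "foldr (\<circ>) (map \<zeta> (d # xs)) id k = \<zeta> c k" if c: "c \<in> set (d # xs)" "k \<in> supp (\<zeta> c)" for c k
  proof (cases "c = d")
    case True
    then have "foldr (\<circ>) (map \<zeta> xs) id k = k"
      using IH dis c by blast
    then show ?thesis using True by simp
  next
    case False
    then have "c \<in> set xs" using c by simp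
    then have "foldr (\<circ>) (map \<zeta> xs) id k = \<zeta> c k" "\<zeta> c k \<notin> supp (\<zeta> d)"
      using IH dis[of c "\<zeta> c k"] supp_image[OF Cons.prems(3)[OF c(1)]] c(2) by blast+
    then show ?thesis
      by (simp add: supp_def)
  qed
  moreover have "foldr (\<circ>) (map \<zeta> (d # xs)) id k = k" if "k \<notin> (\<Union>c\<in>set (d # xs). supp (\<zeta> c))" for k
  proof -
    have "k \<notin> (\<Union>c\<in>set xs. supp (\<zeta> c))" "k \<notin> supp (\<zeta> d)"
      using that by auto
    moreover from this have "foldr (\<circ>) (map \<zeta> xs) id k = k"
      using IH by blast
    ultimately show ?thesis
      by (simp add: supp_def)
  qed
  ultimately show ?case by blast
qed simp

lemma downward_closed_interval:
  assumes "finite A" "\<And>j i. j \<in> A \<Longrightarrow> 1 \<le> i \<Longrightarrow> i < j \<Longrightarrow> i \<in> A" "0 \<notin> A"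
  shows "A = {1..<Suc (card A)}"
proof (cases "A = {}")
  case False
  have "A = {1..Max A}"
  proof (intro subset_antisym subsetI)
    fix i assume "i \<in> A"
    then show "i \<in> {1..Max A}"
      using assms(1,3) by (cases i) auto
  next
    fix i assume "i \<in> {1..Max A}"
    then show "i \<in> A"
      using assms(2)[of "Max A" i] Max_in[OF assms(1) False] by (cases "i = Max A") auto
  qed
  moreover from this have "card A = Max A"
    by (metis card_atLeastAtMost diff_Suc_1)
  ultimately show ?thesis by (simp add: atLeastLessThanSuc_atLeastAtMost)
qed simp

text \<open>The union \<open>B c\<close> of the earlier blocks is an initial segment: an element of
  \<open>{1..n}\<close> below a member of block \<open>d\<close> lies in block \<open>d\<close> or
  an earlier one. Counting it yields the start \<open>a c\<close>, and each block is a difference of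
  two initial segments.\<close>

lemma ordered_blocks_intervals:
  fixes N :: "nat \<Rightarrow> nat set"
  assumes cover: "(\<Union>c\<in>{1..m}. N c) = {1..n}" and ne: "\<And>c. c \<in> {1..m} \<Longrightarrow> N c \<noteq> {}"
    and ord: "\<And>c d i j. c \<in> {1..m} \<Longrightarrow> d \<in> {1..m} \<Longrightarrow> c < d \<Longrightarrow> i \<in> N c \<Longrightarrow> j \<in> N d \<Longrightarrow> i < j"
  shows "\<exists>a. block_order n m N a"
proof -
  define B where "B c = (\<Union>d\<in>{1..<c}. N d)" for c
  define a where "a c = Suc (card (B c))" for c
  have B_eq: "B c = {1..<a c}" if c: "c \<le> Suc m" for c
    unfolding a_def
  proof (rule downward_closed_interval)
    have sub: "B c \<subseteq> {1..n}"
      using c unfolding B_def cover[symmetric] by (intro UN_mono) auto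
    then show "finite (B c)" "0 \<notin> B c"
      by (auto intro: finite_subset)
    fix j i assume "j \<in> B c" and i: "1 \<le> i" "i < j"
    then obtain d where d: "d \<in> {1..<c}" "j \<in> N d" by (auto simp: B_def)
    have "i \<in> {1..n}" using i \<open>j \<in> B c\<close> sub by auto
    then obtain e where e: "e \<in> {1..m}" "i \<in> N e" using cover by blast
    have "\<not> d < e"
      using ord[of d e j i] d e i c by auto
    then show "i \<in> B c"
      using d e by (auto simp: B_def)
  qed
  show ?thesis
  proof (intro exI[of _ a], unfold_locales)
    show "a 1 = 1" by (simp add: a_def B_def)
    have "B (Suc m) = {1..n}"
      unfolding B_def cover[symmetric] by (simp add: atLeastLessThanSuc_atLeastAtMost)
    then show "a (Suc m) = Suc n" by (simp add: a_def)
    fix c assume c: "c \<in> {1..m}"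
    have "B (Suc c) = B c \<union> N c"
      using c by (auto simp: B_def less_Suc_eq)
    moreover have "B c \<inter> N c = {}"
      using ord[of _ c] c by (fastforce simp: B_def)
    ultimately have "N c = B (Suc c) - B c" by blast
    also have "\<dots> = {1..<a (Suc c)} - {1..<a c}"
      using B_eq[of c] B_eq[of "Suc c"] c by simp
    also have "\<dots> = {a c..<a (Suc c)}"
      by (auto simp: a_def)
    finally show "N c = {a c..<a (Suc c)}" .
    with ne[OF c] show "a c < a (Suc c)" by auto
  qed
qed

section \<open>Permutations generated by a block rotation\<close>

context block_order
begin

lemma block_rotation_id: "block_rotation id"
  using a_less by (auto simp: block_rotation_def permutes_id len_def intro!: exI[of _ 0])

lemma block_rotation_comp:
  assumes "block_rotation \<pi>" "block_rotation \<rho>"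
  shows "block_rotation (\<pi> \<circ> \<rho>)"
  unfolding block_rotation_def
proof (intro conjI ballI)
  show "\<pi> \<circ> \<rho> permutes {1..n}"
    using assms permutes_compose by (auto simp: block_rotation_def)
  fix c assume c: "c \<in> {1..m}"
  from assms c obtain u v where uv: "\<forall>r<len c. \<pi> (a c + r) = a c + (r + u) mod len c"
    "\<forall>r<len c. \<rho> (a c + r) = a c + (r + v) mod len c" "v < len c"
    unfolding block_rotation_def by blast
  have "(\<pi> \<circ> \<rho>) (a c + r) = a c + (r + (u + v) mod len c) mod len c" if "r < len c" for r
  proof -
    have "(r + v) mod len c < len c"
      using that by (intro mod_less_divisor) simp
    then have "(\<pi> \<circ> \<rho>) (a c + r) = a c + ((r + v) mod len c + u) mod len c"
      using uv that by simp
    also have "((r + v) mod len c + u) mod len c = (r + (u + v) mod len c) mod len c"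
      by (simp add: mod_simps ac_simps)
    finally show ?thesis .
  qed
  then show "\<exists>u<len c. \<forall>r<len c. (\<pi> \<circ> \<rho>) (a c + r) = a c + (r + u) mod len c"
    using uv(3) by (intro exI[of _ "(u + v) mod len c"]) auto
qed

lemma block_rotation_inv:
  assumes "block_rotation \<pi>"
  shows "block_rotation (inv' \<pi>)"
  unfolding block_rotation_def
proof (intro conjI ballI)
  have perm: "\<pi> permutes {1..n}"
    using assms by (simp add: block_rotation_def)
  then show "inv' \<pi> permutes {1..n}"
    by (rule permutes_inv)
  fix c assume c: "c \<in> {1..m}"
  from assms c obtain u where u: "\<forall>r<len c. \<pi> (a c + r) = a c + (r + u) mod len c" "u < len c"
    unfolding block_rotation_def by blast
  \<comment> \<open>Reducing \<open>len c - u\<close> covers \<open>u = 0\<close>, where it equals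
    \<open>len c\<close> and exceeds the shifts that \<open>block_rotation\<close> allows.\<close>
  have "inv' \<pi> (a c + r) = a c + (r + (len c - u) mod len c) mod len c" if "r < len c" for r
  proof -
    have "((r + (len c - u)) mod len c + u) mod len c = (r + (len c - u) + u) mod len c"
      by (rule mod_add_left_eq)
    then have "\<pi> (a c + (r + (len c - u)) mod len c) = a c + r"
      using u that by simp
    then show ?thesis
      using permutes_inverses(2)[OF perm] by (metis mod_add_right_eq)
  qed
  then show "\<exists>u<len c. \<forall>r<len c. inv' \<pi> (a c + r) = a c + (r + u) mod len c"
    using u(2) by (intro exI[of _ "(len c - u) mod len c"]) auto
qed

lemma block_rotation_generate:
  assumes "\<pi> \<in> generate (sym_group n) {\<gamma>}" "block_rotation \<gamma>"
  shows "block_rotation \<pi>"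
  using assms(1)
proof induction
  case one
  then show ?case using block_rotation_id by (simp only: sym_group_one)
next
  case (inv h)
  then have "h \<in> carrier (sym_group n)"
    using assms(2) by (simp add: sym_group_carrier block_rotation_def)
  then show ?case
    using inv assms(2) block_rotation_inv by simp
next
  case (eng h1 h2)
  then show ?case using block_rotation_comp by (simp only: sym_group_mult)
qed (use assms(2) in simp)

lemma inverse_closed_subgroup:
  assumes "subgroup \<Gamma> (sym_group n)" "\<Gamma> \<subseteq> generate (sym_group n) {\<gamma>}" "block_rotation \<gamma>"
  shows "inverse_closed \<Gamma>"
  unfolding inverse_closed_def
proof
  fix \<pi> assume \<pi>: "\<pi> \<in> \<Gamma>"
  then have "inv' \<pi> \<in> \<Gamma>"
    using subgroup.m_inv_closed[OF assms(1) \<pi>] subgroup.mem_carrier[OF assms(1) \<pi>] by simp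
  then show "block_rotation \<pi> \<and> inv' \<pi> \<in> \<Gamma>"
    using block_rotation_generate \<pi> assms(2,3) by blast
qed

end

theorem proposition3p8:
  fixes n m :: nat
    and \<zeta> :: "nat \<Rightarrow> nat \<Rightarrow> nat"
    and \<gamma> :: "nat \<Rightarrow> nat"
    and \<Gamma> :: "(nat \<Rightarrow> nat) set"
    and I0 I1 :: "nat set"
  assumes "\<gamma> \<in> carrier (sym_group n)"
    and "disjoint_cycles m \<zeta>"
    and "\<gamma> = foldr (\<circ>) (map \<zeta> [1..<Suc m]) id"
    and "\<forall>c\<in>{1..m}. monotone_cycle (\<zeta> c)"
    and "ordered_cycles m \<zeta>"
    and "supp \<gamma> = {1..n}"
    and "subgroup \<Gamma> (sym_group n)"
    and "\<Gamma> \<subseteq> generate (sym_group n) {\<gamma>}"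
    and "I0 \<subseteq> {1..n}" and "I1 \<subseteq> {1..n}" and "I0 \<inter> I1 = {}"
  shows "(\<exists>r. propagate n m (\<lambda>c. supp (\<zeta> c)) \<Gamma> I0 I1 1 True r) \<and>
    (\<forall>r. propagate n m (\<lambda>c. supp (\<zeta> c)) \<Gamma> I0 I1 1 True r \<longrightarrow>
      ((\<exists>s. r = Feasible s) \<longleftrightarrow> symretope n \<Gamma> \<inter> face n I0 I1 \<noteq> {}) \<and>
      ((\<exists>s. r = Feasible s) \<longrightarrow>
        (\<exists>J0 J1. r = Feasible (Some (J0, J1)) \<and>
          J0 = {i \<in> {1..n}. \<forall>x \<in> symretope n \<Gamma> \<inter> face n I0 I1. x i = 0} \<and>
          J1 = {i \<in> {1..n}. \<forall>x \<in> symretope n \<Gamma> \<inter> face n I0 I1. x i = 1})))"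
proof -
  have bij: "bij (\<zeta> c)" if c: "c \<in> {1..m}" for c
  proof -
    obtain cs where "\<zeta> c = cycle_of_list cs"
      using assms(2) c unfolding disjoint_cycles_def nontrivial_cycle_def by blast
    then show ?thesis
      using permutes_bij[OF cycle_permutes[of cs]] by simp
  qed
  have set_upt: "set [1..<Suc m] = {1..m}" by auto
  have "disjoint_family_on (\<lambda>c. supp (\<zeta> c)) {1..m}"
    using assms(2) unfolding disjoint_cycles_def by blast
  then have \<gamma>: "\<forall>c\<in>{1..m}. \<forall>k\<in>supp (\<zeta> c). \<gamma> k = \<zeta> c k"
    "\<forall>k. k \<notin> (\<Union>c\<in>{1..m}. supp (\<zeta> c)) \<longrightarrow> \<gamma> k = k"
    using foldr_disjoint_perms[of "[1..<Suc m]" \<zeta>, unfolded set_upt, folded assms(3)] bij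
    by (meson distinct_upt)+
  have cover: "(\<Union>c\<in>{1..m}. supp (\<zeta> c)) = {1..n}"
  proof (intro subset_antisym subsetI)
    fix k assume "k \<in> (\<Union>c\<in>{1..m}. supp (\<zeta> c))"
    then obtain c where "c \<in> {1..m}" "k \<in> supp (\<zeta> c)" by blast
    then have "\<gamma> k \<noteq> k" using \<gamma>(1) by (simp add: supp_def)
    then have "k \<in> supp \<gamma>" by (simp add: supp_def)
    then show "k \<in> {1..n}" using assms(6) by simp
  next
    fix k assume "k \<in> {1..n}"
    then have "k \<in> supp \<gamma>" using assms(6) by simp
    then have "\<gamma> k \<noteq> k" by (simp add: supp_def)
    then show "k \<in> (\<Union>c\<in>{1..m}. supp (\<zeta> c))" using \<gamma>(2) by blast
  qed
  have "supp (\<zeta> c) \<noteq> {}" if c: "c \<in> {1..m}" for c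
  proof -
    obtain k where "\<zeta> c k < k"
      using assms(4) c unfolding monotone_cycle_def by meson
    then have "k \<in> supp (\<zeta> c)" by (simp add: supp_def)
    then show ?thesis by blast
  qed
  then obtain a where a: "block_order n m (\<lambda>c. supp (\<zeta> c)) a"
    using ordered_blocks_intervals[OF cover] assms(5) unfolding ordered_cycles_def by meson
  interpret block_order n m "\<lambda>c. supp (\<zeta> c)" a by (rule a)
  have "block_rotation \<gamma>"
    unfolding block_rotation_def
  proof (intro conjI ballI)
    show "\<gamma> permutes {1..n}"
      using assms(1) by (simp add: sym_group_carrier)
    fix c assume c: "c \<in> {1..m}"
    \<comment> \<open>The shift is by one, written \<open>1 mod len c\<close> so that the bound
      \<open>u < len c\<close> follows from a positive block length.\<close>
    have "\<gamma> (a c + r) = a c + (r + 1 mod len c) mod len c" if "r < len c" for r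
    proof -
      have "\<gamma> (a c + r) = \<zeta> c (a c + r)"
        using \<gamma>(1) N_nth[OF c] c that by blast
      also have "\<dots> = a c + (r + 1) mod len c"
        using monotone_cycle_successor[OF bij[OF c] _ N_eq[OF c], of r] assms(4) c that
        by (simp add: len_def)
      finally show ?thesis by (simp add: mod_add_right_eq)
    qed
    then show "\<exists>u<len c. \<forall>r<len c. \<gamma> (a c + r) = a c + (r + u) mod len c"
      using a_less[OF c] by (intro exI[of _ "1 mod len c"]) (auto simp: len_def)
  qed
  then have "inverse_closed \<Gamma>"
    using inverse_closed_subgroup assms(7,8) by blast
  note correct = propagate_correct[OF this assms(11,9,10)]
  show ?thesis
    unfolding correct by simp
qed

end
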